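(* Let $Z_t$ be the truncated stochastic approximation process $Z_t=\Phi_{U_t}\big(Z_{t-1}+\gamma_t(Z_{t-1})[R_t(Z_{t-1})+\varepsilon_t(Z_{t-1})]\big)$, $t=1,2,\dots$, described in the context, with $(U_t)$ admissible for $z^0$. Let $\{C_t\}$ be a predictable positive definite (symmetric) $m\times m$ matrix process, and let $\lambda_t^{max}$ and $\lambda_t^{min}$ be the largest and smallest eigenvalues of $C_t$. Put $\Delta_t=Z_t-z^0$. Suppose that: (V1) with $V_t(u)=u^TC_tu$, eventually $V_t(\Delta_t)\le V_t\big(\Delta_{t-1}+\gamma_t(Z_{t-1})[R_t(Z_{t-1})+\varepsilon_t(Z_{t-1})]\big)$; (R1) there exists a predictable non-negative scalar process $\mathcal P_t$ such that eventually $$\frac{2\Delta_{t-1}^TC_t\gamma_t(z^0+\Delta_{t-1})R_t(z^0+\Delta_{t-1})}{\lambda_t^{max}}+\mathcal P_t\le-\rho_t\|\Delta_{t-1}\|^2,$$ where $\rho_t$ is a predictable non-negative scalar process satisfying $$\sum_{t=1}^\infty\left[\frac{\lambda_t^{max}-\lambda_{t-1}^{min}}{\lambda_{t-1}^{min}}-\frac{\lambda_t^{max}}{\lambda_{t-1}^{min}}\rho_t\right]^+<\infty;$$ (R2) $$\sum_{t=1}^\infty\frac{\lambda_t^{max}\left[E\left\{\big\|\gamma_t(z^0+\Delta_{t-1})[R_t(z^0+\Delta_{t-1})+\varepsilon_t(z^0+\Delta_{t-1})]\big\|^2\mid\mathcal F_{t-1}\right\}-\mathcal P_t\right]^+}{1+\lambda_{t-1}^{min}\|\Delta_{t-1}\|^2}<\infty.$$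 Then $(Z_t-z^0)^TC_t(Z_t-z^0)$ converges to a finite limit $P$-a.s.
   Context: Let $(\Omega,\mathcal F,(\mathcal F_t)_{t\ge0},P)$ be a stochastic basis satisfying the usual conditions. For each $t=1,2,\dots$ let $R_t(z)=R_t(z,\omega)\in\mathbb R^m$, $\varepsilon_t(z)=\varepsilon_t(z,\omega)\in\mathbb R^m$ and $\gamma_t(z)=\gamma_t(z,\omega)\in\mathbb R^{m\times m}$ be $\mathcal B(\mathbb R^m)\times\mathcal F$-measurable functions of $(z,\omega)\in\mathbb R^m\times\Omega$ such that for each $z$: $R_t(z)$ and $\gamma_t(z)$ are predictable (i.e. $\mathcal F_{t-1}$-measurable for each $t$), and $\varepsilon_t(z)$ is a martingale difference ($\mathcal F_t$-measurable with $E\{\varepsilon_t(z)\mid\mathcal F_{t-1}\}=0$). There is a non-random $z^0\in\mathbb R^m$ with $R_t(z^0)=0$ for all $t$. For a closed convex $U\subset\mathbb R^m$, $\Phi_U(z)$ is $z$ if $z\in U$ and is the point of $U$ nearest to $z$ (Euclidean distance) otherwise. A random sequence of sets $U_t=U_t(\omega)\subset\mathbb R^m$, $t\ge1$, is admissible for $z^0$ if: each $U_t(\omega)$ is closed and convex; $\Phi_{U_t}(z)$ is $\mathcal F_t$-measurable for each $t$ and $z$; and for almost all $\omega$ there is $t_0(\omega)<\infty$ with $z^0\in U_t(\omega)$ for all $t>t_0(\omega)$. The starting value is $Z_0\in\mathbb R^m$. With $\Psi_t=R_t+\varepsilon_t$ it is assumed throughout that $E\{\Psi_t(Z_{t-1})\mid\mathcal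 F_{t-1}\}=R_t(Z_{t-1})$ and $E\{\varepsilon_t^T(Z_{t-1})\varepsilon_t(Z_{t-1})\mid\mathcal F_{t-1}\}=[E\{\varepsilon_t^T(z)\varepsilon_t(z)\mid\mathcal F_{t-1}\}]_{z=Z_{t-1}}$, and that these conditional expectations are finite. All conditional expectations are computed as integrals with respect to regular conditional probabilities; in particular, conditional expectations of functions of $z^0+\Delta_{t-1}=Z_{t-1}$ given $\mathcal F_{t-1}$ may be computed with $Z_{t-1}$ frozen. Conventions: $[a]^+=\max(a,0)$. A sequence of random variables has a property "eventually" if for $P$-almost every $\omega$ the property holds for all $t>t_0(\omega)$, for some $t_0(\omega)<\infty$. Relations between random variables are understood $P$-a.s. At index $0$, $C_0$ is an $\mathcal F_0$-measurable positive definite matrix. *)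

theory Defs
  imports "HOL-Probability.Probability"
begin

definition eigenvalues :: "real^'m^'m \<Rightarrow> real set" where
  "eigenvalues A = {l. \<exists>v. v \<noteq> 0 \<and> A *v v = l *\<^sub>R v}"

definition lambda_max :: "real^'m^'m \<Rightarrow> real" where
  "lambda_max A = Max (eigenvalues A)"

definition lambda_min :: "real^'m^'m \<Rightarrow> real" where
  "lambda_min A = Min (eigenvalues A)"

definition sym_pos_def :: "real^'m^'m \<Rightarrow> bool" where
  "sym_pos_def A \<longleftrightarrow> transpose A = A \<and> (\<forall>x. x \<noteq> 0 \<longrightarrow> 0 < x \<bullet> (A *v x))"

text \<open>Time is discrete, so right-continuity of the filtration imposes nothing and the usual
  conditions amount to completeness.\<close>

locale stochastic_basis = prob_space M + filtration "space M" F
  for M :: "'a measure" and F :: "nat \<Rightarrow> 'a measure" +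
  assumes subalg: "\<And>t. subalgebra M (F t)"
    and usual: "\<And>N A. A \<in> null_sets M \<Longrightarrow> N \<subseteq> A \<Longrightarrow> N \<in> sets (F 0)"

text \<open>A process is indexed by \<open>t \<ge> 1\<close> here; its value at index 0 is unconstrained.\<close>

definition predictable :: "(nat \<Rightarrow> 'a measure) \<Rightarrow> (nat \<Rightarrow> 'a \<Rightarrow> 'b::topological_space) \<Rightarrow> bool" where
  "predictable F X \<longleftrightarrow> (\<forall>t\<ge>1. X t \<in> borel_measurable (F (t - 1)))"

text \<open>\<open>g\<close> is a version of the componentwise conditional expectation \<open>E(f | G)\<close>. The vector \<open>f\<close> need
  not be integrable: the conditional expectation is taken in the generalised sense, as
  \<open>E(f\<^sup>+ | G) - E(f\<^sup>- | G)\<close> with both parts finite, which is how the library defines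
  \<^const>\<open>real_cond_exp\<close>. The finiteness clause is needed because \<^const>\<open>real_cond_exp\<close> replaces
  infinite values by 0.\<close>

definition is_cond_exp ::
    "'a measure \<Rightarrow> 'a measure \<Rightarrow> ('a \<Rightarrow> real^'m) \<Rightarrow> ('a \<Rightarrow> real^'m) \<Rightarrow> bool" where
  "is_cond_exp M G f g \<longleftrightarrow>
     f \<in> borel_measurable M \<and> g \<in> borel_measurable G \<and>
     (AE \<omega> in M. nn_cond_exp M G (\<lambda>\<omega>. ennreal (norm (f \<omega>))) \<omega> < \<infinity>) \<and>
     (\<forall>i. AE \<omega> in M. real_cond_exp M G (\<lambda>\<omega>. f \<omega> $ i) \<omega> = g \<omega> $ i)"

text \<open>The projection \<open>\<Phi>\<^sub>U\<close> is \<^const>\<open>closest_point\<close>; the sets are non-empty, without which it is not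
  defined.\<close>

definition admissible ::
    "'a measure \<Rightarrow> (nat \<Rightarrow> 'a measure) \<Rightarrow> real^'m \<Rightarrow> (nat \<Rightarrow> 'a \<Rightarrow> (real^'m) set) \<Rightarrow> bool" where
  "admissible M F z0 U \<longleftrightarrow>
     (\<forall>t\<ge>1. \<forall>\<omega>\<in>space M. closed (U t \<omega>) \<and> convex (U t \<omega>) \<and> U t \<omega> \<noteq> {}) \<and>
     (\<forall>t\<ge>1. \<forall>z. (\<lambda>\<omega>. closest_point (U t \<omega>) z) \<in> borel_measurable (F t)) \<and>
     (AE \<omega> in M. \<exists>t0. \<forall>t>t0. z0 \<in> U t \<omega>)"

text \<open>
  The last four assumptions render the convention that conditional expectations given
  \<open>F (t - 1)\<close> of functions of \<open>Z (t - 1)\<close> are computed with \<open>Z (t - 1)\<close> frozen.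

  \<open>gamma_frozen\<close> and \<open>eps_frozen\<close> are the cases \<open>E(\<gamma>\<^sub>t(Z\<^sub>t\<^sub>-\<^sub>1) | F\<^sub>t\<^sub>-\<^sub>1) = \<gamma>\<^sub>t(Z\<^sub>t\<^sub>-\<^sub>1)\<close> and
  \<open>E(\<epsilon>\<^sub>t(Z\<^sub>t\<^sub>-\<^sub>1) | F\<^sub>t) = \<epsilon>\<^sub>t(Z\<^sub>t\<^sub>-\<^sub>1)\<close>: substituting \<open>Z\<^sub>t\<^sub>-\<^sub>1\<close> for \<open>z\<close> keeps \<open>\<gamma>\<^sub>t(z)\<close> predictable and
  \<open>\<epsilon>\<^sub>t(z)\<close> adapted. Measurability for each fixed \<open>z\<close> and joint measurability over the full
  sigma-algebra of \<open>M\<close> do not imply this. For \<open>R\<close> it is part of \<open>Psi_frozen\<close>.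

  In \<open>eps_sq_frozen\<close> the substitution into \<open>E(\<epsilon>\<^sub>t\<^sup>T(z) \<epsilon>\<^sub>t(z) | F\<^sub>t\<^sub>-\<^sub>1)\<close>, which for each \<open>z\<close> is
  determined only up to a null set depending on \<open>z\<close>, refers to a jointly measurable version \<open>q\<close>.
\<close>

locale truncated_SA = stochastic_basis M F
  for M :: "'a measure" and F :: "nat \<Rightarrow> 'a measure" +
  fixes R \<epsilon> :: "nat \<Rightarrow> real^'m \<Rightarrow> 'a \<Rightarrow> real^'m"
    and \<gamma> :: "nat \<Rightarrow> real^'m \<Rightarrow> 'a \<Rightarrow> real^'m^'m"
    and z0 :: "real^'m"
    and U :: "nat \<Rightarrow> 'a \<Rightarrow> (real^'m) set"
    and Z :: "nat \<Rightarrow> 'a \<Rightarrow> real^'m"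
  assumes R_joint: "\<And>t. t \<ge> 1 \<Longrightarrow> (\<lambda>(z, \<omega>). R t z \<omega>) \<in> borel_measurable (borel \<Otimes>\<^sub>M M)"
    and eps_joint: "\<And>t. t \<ge> 1 \<Longrightarrow> (\<lambda>(z, \<omega>). \<epsilon> t z \<omega>) \<in> borel_measurable (borel \<Otimes>\<^sub>M M)"
    and gamma_joint: "\<And>t. t \<ge> 1 \<Longrightarrow> (\<lambda>(z, \<omega>). \<gamma> t z \<omega>) \<in> borel_measurable (borel \<Otimes>\<^sub>M M)"
    and R_predictable: "\<And>z. predictable F (\<lambda>t. R t z)"
    and gamma_predictable: "\<And>z. predictable F (\<lambda>t. \<gamma> t z)"
    and eps_adapted: "\<And>t z. t \<ge> 1 \<Longrightarrow> \<epsilon> t z \<in> borel_measurable (F t)"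
    and eps_martingale_diff: "\<And>t z. t \<ge> 1 \<Longrightarrow> is_cond_exp M (F (t - 1)) (\<epsilon> t z) (\<lambda>_. 0)"
    and R_root: "\<And>t. t \<ge> 1 \<Longrightarrow> AE \<omega> in M. R t z0 \<omega> = 0"
    and U_admissible: "admissible M F z0 U"
    and Z_start: "Z 0 \<in> borel_measurable (F 0)"
    and Z_step: "\<And>t \<omega>. t \<ge> 1 \<Longrightarrow> \<omega> \<in> space M \<Longrightarrow>
      Z t \<omega> = closest_point (U t \<omega>)
        (Z (t - 1) \<omega> + \<gamma> t (Z (t - 1) \<omega>) \<omega> *v (R t (Z (t - 1) \<omega>) \<omega> + \<epsilon> t (Z (t - 1) \<omega>) \<omega>))"
    and gamma_frozen: "\<And>t. t \<ge> 1 \<Longrightarrow> (\<lambda>\<omega>. \<gamma> t (Z (t - 1) \<omega>) \<omega>) \<in> borel_measurable (F (t - 1))"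
    and eps_frozen: "\<And>t. t \<ge> 1 \<Longrightarrow> (\<lambda>\<omega>. \<epsilon> t (Z (t - 1) \<omega>) \<omega>) \<in> borel_measurable (F t)"
    and Psi_frozen: "\<And>t. t \<ge> 1 \<Longrightarrow>
      is_cond_exp M (F (t - 1))
        (\<lambda>\<omega>. R t (Z (t - 1) \<omega>) \<omega> + \<epsilon> t (Z (t - 1) \<omega>) \<omega>)
        (\<lambda>\<omega>. R t (Z (t - 1) \<omega>) \<omega>)"
    and eps_sq_frozen: "\<And>t. t \<ge> 1 \<Longrightarrow>
      \<exists>q :: real^'m \<Rightarrow> 'a \<Rightarrow> ennreal.
        (\<lambda>(z, \<omega>). q z \<omega>) \<in> borel_measurable (borel \<Otimes>\<^sub>M F (t - 1)) \<and>
        (\<forall>z. AE \<omega> in M.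
           nn_cond_exp M (F (t - 1)) (\<lambda>\<omega>. ennreal (\<epsilon> t z \<omega> \<bullet> \<epsilon> t z \<omega>)) \<omega> = q z \<omega>) \<and>
        (AE \<omega> in M.
           nn_cond_exp M (F (t - 1))
             (\<lambda>\<omega>. ennreal (\<epsilon> t (Z (t - 1) \<omega>) \<omega> \<bullet> \<epsilon> t (Z (t - 1) \<omega>) \<omega>)) \<omega> = q (Z (t - 1) \<omega>) \<omega> \<and>
           q (Z (t - 1) \<omega>) \<omega> < \<infinity>)"

end

theory Submission
  imports Defs
begin

text \<open>
  Write \<open>v\<^sub>t = \<Delta>\<^sub>t\<^sup>T C\<^sub>t \<Delta>\<^sub>t\<close> and let \<open>x\<^sub>t\<close> be the value of the quadratic form of \<open>C\<^sub>t\<close> at the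
  untruncated point \<open>\<Delta>\<^sub>t\<^sub>-\<^sub>1 + \<gamma>\<^sub>t \<Psi>\<^sub>t\<close>. By (V1), truncation eventually does not increase the form, so
  \<open>v\<^sub>t \<le> x\<^sub>t\<close>. Expanding \<open>x\<^sub>t\<close> and taking the conditional expectation, the noise drops out of the
  cross term and the square is at most \<open>\<lambda>\<^sub>t\<^sup>m\<^sup>a\<^sup>x E(\<parallel>\<gamma>\<^sub>t \<Psi>\<^sub>t\<parallel>\<^sup>2 | F\<^sub>t\<^sub>-\<^sub>1)\<close>. Condition (R1) bounds the cross
  term, the Rayleigh bounds turn \<open>\<parallel>\<Delta>\<^sub>t\<^sub>-\<^sub>1\<parallel>\<^sup>2\<close> into \<open>v\<^sub>t\<^sub>-\<^sub>1\<close>, and what remains is eventually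
  \<open>E(x\<^sub>t | F\<^sub>t\<^sub>-\<^sub>1) \<le> v\<^sub>t\<^sub>-\<^sub>1 + b\<^sub>t (1 + v\<^sub>t\<^sub>-\<^sub>1)\<close>, where \<open>b\<^sub>t\<close> is the sum of the terms of the series in (R1) and
  (R2), hence summable (\<open>nn_cond_exp_affine\<close>, \<open>lyapunov_drift_bound\<close>). So \<open>v\<close> is an almost
  supermartingale in the sense of Robbins and Siegmund, and converges.

  The convergence theorem is built up in three layers. A nonnegative supermartingale converges
  because the expected number of its upcrossings of \<open>[a, b]\<close> is at most \<open>a / (b - a)\<close>
  (\<open>nonneg_supermartingale_convergence\<close>). A process that has the supermartingale inequalities only
  from a random time on is handled by setting it to zero once an inequality fails after
  time \<open>N\<close>: the result is a supermartingale for every \<open>N\<close>, and almost surely it coincides with the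
  original process from \<open>N\<close> on for some \<open>N\<close> (\<open>eventual_supermartingale_convergence\<close>). Finally,
  dividing \<open>1 + v\<^sub>n\<close> by a convergent product \<open>\<Prod>(1 + \<beta>\<^sub>k)\<close> removes the summable perturbation
  (\<open>robbins_siegmund\<close>).

  The \<open>v\<^sub>t\<close> are in general not integrable, and \<open>\<Psi>\<^sub>t\<close> has only a generalised conditional expectation.
  All conditional expectations are therefore those of
  \<open>[0, \<infinity>]\<close>-valued functions, and the signed cross term is dealt with by moving its negative parts to
  the other side of the equation.
\<close>

section \<open>Convergence of nonnegative supermartingales\<close>

text \<open>
  The state of an upcrossing counter for \<open>[a, b]\<close>: \<open>below\<close> holds while the sequence has been at most \<open>a\<close>
  and has not reached \<open>b\<close> since, so an upcrossing is completed when it holds and \<open>b\<close> is reached.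
\<close>

primrec below :: "ennreal \<Rightarrow> ennreal \<Rightarrow> (nat \<Rightarrow> ennreal) \<Rightarrow> nat \<Rightarrow> bool" where
  "below a b y 0 \<longleftrightarrow> y 0 \<le> a"
| "below a b y (Suc n) \<longleftrightarrow> (if below a b y n then y (Suc n) < b else y (Suc n) \<le> a)"

primrec upcrossings :: "ennreal \<Rightarrow> ennreal \<Rightarrow> (nat \<Rightarrow> ennreal) \<Rightarrow> nat \<Rightarrow> nat" where
  "upcrossings a b y 0 = 0"
| "upcrossings a b y (Suc n) = upcrossings a b y n + of_bool (below a b y n \<and> b \<le> y (Suc n))"

text \<open>
  This potential replaces Doob's upcrossing inequality. It cannot increase when the state
  changes: on reaching \<open>a\<close> the constant \<open>a\<close> is traded for a smaller value \<open>y n\<close>, and on reaching \<open>b\<close> the value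
  \<open>y n \<ge> b\<close> is traded for \<open>(b - a) + a\<close>. Between changes it moves with \<open>y\<close> or is constant, so it is a
  supermartingale when \<open>y\<close> is, and as it starts at most at \<open>a\<close>, the expected number of
  upcrossings is at most \<open>a / (b - a)\<close>. It is nonnegative, which keeps all of this in \<open>[0, \<infinity>]\<close>.
\<close>

definition upcrossing_potential where
  "upcrossing_potential a b y n =
    of_nat (upcrossings a b y n) * (b - a) + (if below a b y n then y n else a)"

lemma upcrossing_potential_0: "upcrossing_potential a b y 0 \<le> a"
  by (simp add: upcrossing_potential_def)

lemma upcrossing_potential_Suc:
  assumes "a < b" "b < \<infinity>"
  shows "upcrossing_potential a b y (Suc n)
    \<le> of_nat (upcrossings a b y n) * (b - a) + (if below a b y n then y (Suc n) else a)"
proof (cases "below a b y n \<and> b \<le> y (Suc n)")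
  case True
  let ?k = "of_nat (upcrossings a b y n) :: ennreal"
  have "b - a + a = b"
    using assms by (simp add: diff_add_cancel_ennreal)
  then have "(?k + 1) * (b - a) + a = ?k * (b - a) + b"
    by (simp add: distrib_right add.assoc)
  also have "\<dots> \<le> ?k * (b - a) + y (Suc n)"
    using True by (intro add_left_mono) auto
  finally show ?thesis
    using True by (auto simp: upcrossing_potential_def add.commute)
qed (auto simp: upcrossing_potential_def intro!: add_left_mono)

lemma mono_upcrossings: "mono (upcrossings a b y)"
  by (rule incseq_SucI) simp

text \<open>
  From any time on, the sequence first gets to \<open>a\<close> and then, at the least later time \<open>j\<close> with
  \<open>b \<le> y j\<close>, completes one more upcrossing.
\<close>

lemma upcrossings_unbounded:
  assumes "a < b" and lo: "\<exists>\<^sub>F n in sequentially. y n \<le> a" and hi: "\<exists>\<^sub>F n in sequentially. b \<le> y n"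
  shows "\<exists>n. upcrossings a b y n \<ge> k"
proof (induction k)
  case (Suc k)
  then obtain n where n: "k \<le> upcrossings a b y n" by blast
  obtain m where m: "m > n" "y m \<le> a"
    using lo unfolding frequently_sequentially by (meson Suc_le_lessD)
  then obtain m' where m': "m = Suc m'" "m' \<ge> n" by (cases m) auto
  have act: "below a b y m"
    using m(2) m' \<open>a < b\<close> by auto
  obtain j0 where j0: "j0 > m" "b \<le> y j0"
    using hi unfolding frequently_sequentially by (meson Suc_le_lessD)
  define j where "j = (LEAST j. j > m \<and> b \<le> y j)"
  have j: "j > m" "b \<le> y j" "\<And>i. m < i \<Longrightarrow> i < j \<Longrightarrow> y i < b"
    using LeastI[of "\<lambda>j. j > m \<and> b \<le> y j", OF conjI[OF j0]] not_less_Least[of _ "\<lambda>j. j > m \<and> b \<le> y j"]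
    unfolding j_def[symmetric] by (auto simp: not_le)
  have "below a b y (m + i)" if "m + i < j" for i
    using that by (induction i) (use act j in auto)
  from this[of "j - 1 - m"] j obtain j' where j': "j = Suc j'" "below a b y j'" "j' \<ge> m"
    by (cases j) auto
  have "upcrossings a b y n \<le> upcrossings a b y j'"
    using mono_upcrossings j' m by (auto simp: mono_def)
  with n j' j have "Suc k \<le> upcrossings a b y j" by auto
  then show ?case by blast
qed auto

text \<open>
  Otherwise two rationals fit strictly between the lower and the upper limit, and the interval between
  them is crossed infinitely often. Countably many intervals are enough, so almost sure bounds for
  each of them can be combined.
\<close>

lemma convergent_if_finitely_many_upcrossings:
  fixes y :: "nat \<Rightarrow> ennreal"
  assumes "\<And>p q :: rat. 0 \<le> p \<Longrightarrow> p < q \<Longrightarrow>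
    \<exists>k. \<forall>n. upcrossings (ennreal (real_of_rat p)) (ennreal (real_of_rat q)) y n < k"
  shows "y \<longlonglongrightarrow> liminf y"
proof -
  have "limsup y \<le> liminf y"
  proof (rule ccontr)
    assume "\<not> ?thesis"
    then have "liminf y < limsup y" by simp
    then obtain p where p: "liminf y < ennreal (real_of_rat p)" "ennreal (real_of_rat p) < limsup y"
      using ennreal_rat_dense by metis
    then obtain q where q: "ennreal (real_of_rat p) < ennreal (real_of_rat q)" "ennreal (real_of_rat q) < limsup y"
      using ennreal_rat_dense by metis
    have pq: "p \<ge> 0" "p < q"
      using p q by (metis ennreal_neg leI less_eq_real_def not_less_zero of_rat_less_0_iff)
        (metis ennreal_leI leD leI of_rat_less_eq q(1))
    have "\<exists>\<^sub>F n in sequentially. y n \<le> ennreal (real_of_rat p)"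
    proof (rule ccontr)
      assume "\<not> ?thesis"
      then have "\<forall>\<^sub>F n in sequentially. ennreal (real_of_rat p) \<le> y n"
        by (simp add: not_frequently) (auto elim: eventually_mono)
      then show False using p(1) by (metis Liminf_bounded leD)
    qed
    moreover have "\<exists>\<^sub>F n in sequentially. ennreal (real_of_rat q) \<le> y n"
    proof (rule ccontr)
      assume "\<not> ?thesis"
      then have "\<forall>\<^sub>F n in sequentially. y n \<le> ennreal (real_of_rat q)"
        by (simp add: not_frequently) (auto elim: eventually_mono)
      then show False using q(2) by (metis Limsup_bounded leD)
    qed
    ultimately show False
      using assms[OF pq] upcrossings_unbounded[OF q(1)] by (meson leD)
  qed
  then show ?thesis
    using Liminf_le_Limsup[of sequentially y] by (intro Liminf_eq_Limsup) auto
qed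

text \<open>
  These conditions single out no time, so that they pass to the shift \<open>\<lambda>n. F (N + n)\<close>, by which a
  process is started at time \<open>N\<close>.
\<close>

locale discrete_filtration = prob_space M for M :: "'a measure" +
  fixes F :: "nat \<Rightarrow> 'a measure"
  assumes subalgebra_F: "\<And>n. subalgebra M (F n)"
    and F_mono: "\<And>m n. m \<le> n \<Longrightarrow> sets (F m) \<subseteq> sets (F n)"
begin

lemma sigma_finite_subalgebra_F: "sigma_finite_subalgebra M (F n)"
proof -
  interpret finite_measure_subalgebra M "F n" by unfold_locales (rule subalgebra_F)
  show ?thesis by unfold_locales
qed

lemma measurable_F_mono: "m \<le> n \<Longrightarrow> f \<in> measurable (F m) N \<Longrightarrow> f \<in> measurable (F n) N"
  using F_mono[of m n] subalgebra_F by (auto simp: measurable_def subalgebra_def)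

lemma measurable_F_M: "f \<in> measurable (F m) N \<Longrightarrow> f \<in> measurable M N"
  by (rule measurable_from_subalg[OF subalgebra_F])

lemma measurable_F_Suc: "f \<in> measurable (F m) N \<Longrightarrow> f \<in> measurable (F (Suc m)) N"
  by (rule measurable_F_mono[of m]) auto

text \<open>
  The only way in which the supermartingale property enters. The weight \<open>h\<close> will be the indicator of a
  past event.
\<close>

lemma nn_integral_supermartingale_step:
  assumes [measurable]: "h \<in> borel_measurable (F n)" "Y' \<in> borel_measurable M"
    and le: "AE \<omega> in M. nn_cond_exp M (F n) Y' \<omega> \<le> Y \<omega>"
  shows "(\<integral>\<^sup>+\<omega>. h \<omega> * Y' \<omega> \<partial>M) \<le> (\<integral>\<^sup>+\<omega>. h \<omega> * Y \<omega> \<partial>M)"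
proof -
  have "(\<integral>\<^sup>+\<omega>. h \<omega> * Y' \<omega> \<partial>M) = (\<integral>\<^sup>+\<omega>. h \<omega> * nn_cond_exp M (F n) Y' \<omega> \<partial>M)"
    by (simp add: sigma_finite_subalgebra.nn_cond_exp_intg[OF sigma_finite_subalgebra_F])
  also have "\<dots> \<le> (\<integral>\<^sup>+\<omega>. h \<omega> * Y \<omega> \<partial>M)"
    using le by (intro nn_integral_mono_AE) (auto elim!: eventually_mono intro: mult_left_mono)
  finally show ?thesis .
qed

context
  fixes Y :: "nat \<Rightarrow> 'a \<Rightarrow> ennreal"
  assumes adapted: "\<And>n. Y n \<in> borel_measurable (F n)"
    and supermartingale: "\<And>n. AE \<omega> in M. nn_cond_exp M (F n) (Y (Suc n)) \<omega> \<le> Y n \<omega>"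
begin

lemma adapted_M: "Y n \<in> borel_measurable M"
  using adapted measurable_F_M by blast

lemma measurable_below: "Measurable.pred (F n) (\<lambda>\<omega>. below a b (\<lambda>k. Y k \<omega>) n)"
proof (induction n)
  case 0
  note adapted[of 0, measurable]
  show ?case by simp
next
  case (Suc n)
  note adapted[of "Suc n", measurable] measurable_F_Suc[OF Suc, measurable]
  show ?case by simp
qed

lemma measurable_upcrossings:
  "(\<lambda>\<omega>. upcrossings a b (\<lambda>k. Y k \<omega>) n) \<in> measurable (F n) (count_space UNIV)"
proof (induction n)
  case (Suc n)
  note adapted[of "Suc n", measurable] measurable_F_Suc[OF Suc, measurable]
    measurable_F_Suc[OF measurable_below[where a=a and b=b and n=n], measurable]
  show ?case unfolding upcrossings.simps of_bool_def by measurable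
qed simp

lemma nn_integral_upcrossing_potential:
  assumes "a < b" "b < \<infinity>"
  shows "(\<integral>\<^sup>+\<omega>. upcrossing_potential a b (\<lambda>k. Y k \<omega>) n \<partial>M) \<le> a"
proof (induction n)
  case 0
  have "(\<integral>\<^sup>+\<omega>. upcrossing_potential a b (\<lambda>k. Y k \<omega>) 0 \<partial>M) \<le> (\<integral>\<^sup>+\<omega>. a \<partial>M)"
    by (intro nn_integral_mono upcrossing_potential_0)
  then show ?case by (simp add: emeasure_space_1)
next
  case (Suc n)
  note [measurable] = adapted_M measurable_below[where a=a and b=b and n=n]
    measurable_below[where a=a and b=b and n=n, THEN measurable_F_M]
    measurable_upcrossings[where a=a and b=b and n=n, THEN measurable_F_M]
  define c where "c \<omega> = of_nat (upcrossings a b (\<lambda>k. Y k \<omega>) n) * (b - a)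
      + (if below a b (\<lambda>k. Y k \<omega>) n then 0 else a)" for \<omega>
  define h where "h \<omega> = (if below a b (\<lambda>k. Y k \<omega>) n then 1 else 0 :: ennreal)" for \<omega>
  have [measurable]: "c \<in> borel_measurable M" "h \<in> borel_measurable (F n)" "h \<in> borel_measurable M"
    unfolding c_def h_def by measurable
  have "(\<integral>\<^sup>+\<omega>. upcrossing_potential a b (\<lambda>k. Y k \<omega>) (Suc n) \<partial>M) \<le> (\<integral>\<^sup>+\<omega>. c \<omega> + h \<omega> * Y (Suc n) \<omega> \<partial>M)"
    by (intro nn_integral_mono order_trans[OF upcrossing_potential_Suc[OF assms]]) (auto simp: c_def h_def)
  also have "\<dots> = (\<integral>\<^sup>+\<omega>. c \<omega> \<partial>M) + (\<integral>\<^sup>+\<omega>. h \<omega> * Y (Suc n) \<omega> \<partial>M)"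
    by (intro nn_integral_add) auto
  also have "\<dots> \<le> (\<integral>\<^sup>+\<omega>. c \<omega> \<partial>M) + (\<integral>\<^sup>+\<omega>. h \<omega> * Y n \<omega> \<partial>M)"
    by (intro add_left_mono nn_integral_supermartingale_step[of h n] supermartingale) auto
  also have "\<dots> = (\<integral>\<^sup>+\<omega>. c \<omega> + h \<omega> * Y n \<omega> \<partial>M)"
    by (intro nn_integral_add[symmetric]) auto
  also have "\<dots> = (\<integral>\<^sup>+\<omega>. upcrossing_potential a b (\<lambda>k. Y k \<omega>) n \<partial>M)"
    by (intro nn_integral_cong) (auto simp: c_def h_def upcrossing_potential_def)
  finally show ?case using Suc by order
qed

text \<open>
  By monotone convergence the supremum of the upcrossing numbers has finite expectation.
\<close>

lemma AE_finitely_many_upcrossings: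
  assumes "a < b" "b < \<infinity>"
  shows "AE \<omega> in M. \<exists>k. \<forall>n. upcrossings a b (\<lambda>k. Y k \<omega>) n < k"
proof -
  let ?u = "\<lambda>n \<omega>. of_nat (upcrossings a b (\<lambda>k. Y k \<omega>) n) :: ennreal"
  note [measurable] = adapted_M measurable_upcrossings[THEN measurable_F_M]
  have pos: "b - a > 0" "b - a < \<infinity>"
    using assms by (auto simp: diff_gr0_ennreal less_top[symmetric] ennreal_minus_eq_top)
  have "(\<integral>\<^sup>+\<omega>. (SUP n. ?u n \<omega> * (b - a)) \<partial>M) = (SUP n. \<integral>\<^sup>+\<omega>. ?u n \<omega> * (b - a) \<partial>M)"
    using mono_upcrossings
    by (intro nn_integral_monotone_convergence_SUP) (auto simp: incseq_def le_fun_def intro!: mult_right_mono dest: monoD)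
  also have "\<dots> \<le> a"
  proof (rule SUP_least)
    fix n
    have "(\<integral>\<^sup>+\<omega>. ?u n \<omega> * (b - a) \<partial>M) \<le> (\<integral>\<^sup>+\<omega>. upcrossing_potential a b (\<lambda>k. Y k \<omega>) n \<partial>M)"
      by (intro nn_integral_mono) (auto simp: upcrossing_potential_def)
    then show "(\<integral>\<^sup>+\<omega>. ?u n \<omega> * (b - a) \<partial>M) \<le> a"
      using nn_integral_upcrossing_potential[OF assms] by (rule order_trans)
  qed
  finally have "(\<integral>\<^sup>+\<omega>. (SUP n. ?u n \<omega> * (b - a)) \<partial>M) \<noteq> \<infinity>"
    using assms by (auto simp: top_unique)
  then have "AE \<omega> in M. (SUP n. ?u n \<omega> * (b - a)) \<noteq> \<infinity>"
    by (intro nn_integral_PInf_AE) auto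
  then show ?thesis
  proof eventually_elim
    case (elim \<omega>)
    have "(SUP n. ?u n \<omega>) * (b - a) \<noteq> \<infinity>"
      using elim by (simp add: SUP_mult_right_ennreal)
    then have "(SUP n. ?u n \<omega>) < \<infinity>"
      using pos by (auto simp: ennreal_mult_eq_top_iff less_top[symmetric])
    then obtain k :: nat where k: "(SUP n. ?u n \<omega>) < of_nat k"
      using ennreal_Ex_less_of_nat[of "SUP n. ?u n \<omega>"] by auto
    have "?u n \<omega> < of_nat k" for n
      by (rule le_less_trans[OF SUP_upper k]) simp
    then show ?case by auto
  qed
qed

text \<open>
  The upcrossing bound gives a limit in \<open>[0, \<infinity>]\<close>. That it is finite where the process starts at a
  finite value is Fatou's lemma, applied on each of the events \<open>Y\<^sub>0 \<le> K\<close>, on which the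
  expectations are at most \<open>K\<close>.
\<close>

lemma nonneg_supermartingale_convergence:
  "AE \<omega> in M. \<exists>l. (\<lambda>n. Y n \<omega>) \<longlonglongrightarrow> l \<and> (Y 0 \<omega> < \<infinity> \<longrightarrow> l < \<infinity>)"
proof -
  note adapted_M[measurable]
  have 1: "AE \<omega> in M. \<forall>p q :: rat. 0 \<le> p \<longrightarrow> p < q \<longrightarrow>
    (\<exists>k. \<forall>n. upcrossings (ennreal (real_of_rat p)) (ennreal (real_of_rat q)) (\<lambda>k. Y k \<omega>) n < k)"
  proof (intro AE_all_countable[THEN iffD2] allI)
    fix p q :: rat
    have "ennreal (real_of_rat p) < ennreal (real_of_rat q)" if "0 \<le> p" "p < q"
      using that by (intro ennreal_lessI) (auto simp: of_rat_less)
    then show "AE \<omega> in M. 0 \<le> p \<longrightarrow> p < q \<longrightarrow>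
      (\<exists>k. \<forall>n. upcrossings (ennreal (real_of_rat p)) (ennreal (real_of_rat q)) (\<lambda>k. Y k \<omega>) n < k)"
      using AE_finitely_many_upcrossings[of "ennreal (real_of_rat p)" "ennreal (real_of_rat q)"]
      by (cases "0 \<le> p \<and> p < q") (auto simp: less_top[symmetric])
  qed
  have 2: "AE \<omega> in M. \<forall>K::nat. Y 0 \<omega> \<le> of_nat K \<longrightarrow> liminf (\<lambda>n. Y n \<omega>) < \<infinity>"
  proof (intro AE_all_countable[THEN iffD2] allI)
    fix K :: nat
    define h where "h \<omega> = (if Y 0 \<omega> \<le> of_nat K then 1 else 0 :: ennreal)" for \<omega>
    have h: "h \<in> borel_measurable (F n)" for n
    proof -
      note measurable_F_mono[OF _ adapted, of 0 n, measurable]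
      show ?thesis unfolding h_def by measurable
    qed
    have [measurable]: "h \<in> borel_measurable M" using h measurable_F_M by blast
    have bd: "(\<integral>\<^sup>+\<omega>. h \<omega> * Y n \<omega> \<partial>M) \<le> of_nat K" for n
    proof (induction n)
      case 0
      have "(\<integral>\<^sup>+\<omega>. h \<omega> * Y 0 \<omega> \<partial>M) \<le> (\<integral>\<^sup>+\<omega>. of_nat K \<partial>M)"
        by (intro nn_integral_mono) (auto simp: h_def)
      then show ?case by (simp add: emeasure_space_1)
    next
      case (Suc n)
      have "(\<integral>\<^sup>+\<omega>. h \<omega> * Y (Suc n) \<omega> \<partial>M) \<le> (\<integral>\<^sup>+\<omega>. h \<omega> * Y n \<omega> \<partial>M)"
        by (intro nn_integral_supermartingale_step[of h n] h supermartingale) auto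
      with Suc show ?case by order
    qed
    have "(\<integral>\<^sup>+\<omega>. liminf (\<lambda>n. h \<omega> * Y n \<omega>) \<partial>M) \<le> liminf (\<lambda>n. \<integral>\<^sup>+\<omega>. h \<omega> * Y n \<omega> \<partial>M)"
      by (intro nn_integral_liminf) auto
    also have "\<dots> \<le> liminf (\<lambda>n::nat. of_nat K)"
      by (intro Liminf_mono always_eventually allI bd)
    also have "\<dots> = of_nat K"
      by (simp add: Liminf_const)
    finally have "(\<integral>\<^sup>+\<omega>. liminf (\<lambda>n. h \<omega> * Y n \<omega>) \<partial>M) \<noteq> \<infinity>"
      by (auto simp: top_unique)
    then have "AE \<omega> in M. liminf (\<lambda>n. h \<omega> * Y n \<omega>) \<noteq> \<infinity>"
      by (intro nn_integral_PInf_AE) auto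
    then show "AE \<omega> in M. Y 0 \<omega> \<le> of_nat K \<longrightarrow> liminf (\<lambda>n. Y n \<omega>) < \<infinity>"
      by eventually_elim (auto simp: h_def less_top[symmetric])
  qed
  from 1 2 show ?thesis
  proof eventually_elim
    case (elim \<omega>)
    have "(\<lambda>n. Y n \<omega>) \<longlonglongrightarrow> liminf (\<lambda>n. Y n \<omega>)"
      by (rule convergent_if_finitely_many_upcrossings) (use elim in auto)
    moreover have "liminf (\<lambda>n. Y n \<omega>) < \<infinity>" if "Y 0 \<omega> < \<infinity>"
      using that elim(2) ennreal_Ex_less_of_nat[of "Y 0 \<omega>"] by (auto intro: less_imp_le)
    ultimately show ?case by blast
  qed
qed

end

end

section \<open>Almost supermartingales\<close>

lemma ennreal_suminf_finite_imp_terms_finite: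
  fixes f :: "nat \<Rightarrow> ennreal"
  assumes "(\<Sum>n. f n) < \<infinity>"
  shows "\<forall>n. f n < \<infinity>"
proof
  fix n
  show "f n < \<infinity>"
    using sum_le_suminf[of f "{n}"] assms by (simp add: le_less_trans)
qed

context discrete_filtration
begin

text \<open>
  The intermediate process \<open>X\<close> separates two inequalities that may fail at finitely many random
  times: the pathwise \<open>Y (n + 1) \<le> X n\<close>, visible at time \<open>n + 1\<close>, and the conditional
  \<open>E(X n | F n) \<le> Y n\<close>, visible already at time \<open>n\<close>. Because of the latter, multiplying by the
  indicator of the second inequality commutes with the conditional expectation; therefore the
  stopped process \<open>W N\<close> in the proof is a supermartingale.
\<close>

lemma eventual_supermartingale_convergence:
  fixes Y X :: "nat \<Rightarrow> 'a \<Rightarrow> ennreal"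
  assumes Y: "\<And>n. Y n \<in> borel_measurable (F n)" and X: "\<And>n. X n \<in> borel_measurable (F (Suc n))"
    and YX: "AE \<omega> in M. \<forall>\<^sub>F n in sequentially. Y (Suc n) \<omega> \<le> X n \<omega>"
    and XY: "AE \<omega> in M. \<forall>\<^sub>F n in sequentially. nn_cond_exp M (F n) (X n) \<omega> \<le> Y n \<omega>"
    and finite: "AE \<omega> in M. \<forall>n. Y n \<omega> < \<infinity>"
  shows "AE \<omega> in M. \<exists>l<\<infinity>. (\<lambda>n. Y n \<omega>) \<longlonglongrightarrow> l"
proof -
  define E where "E n = nn_cond_exp M (F n) (X n)" for n
  have E: "E n \<in> borel_measurable (F n)" for n
    by (simp add: E_def)
  define ok where "ok n \<omega> \<longleftrightarrow> Y (Suc n) \<omega> \<le> X n \<omega> \<and> E n \<omega> \<le> Y n \<omega>"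
    for n \<omega>
  define ok_upto where "ok_upto N n \<omega> \<longleftrightarrow> (\<forall>k<n. ok (N + k) \<omega>)" for N n \<omega>
  \<comment> \<open>The process from time \<open>N\<close> on, set to zero for good after the first failure. Decreasing
    indicators preserve the supermartingale inequality of a nonnegative process.\<close>
  define W where "W N n \<omega> = (if ok_upto N n \<omega> then Y (N + n) \<omega> else 0)" for N n \<omega>
  have ok_meas: "Measurable.pred (F m) (ok n)" if "Suc n \<le> m" for n m
  proof -
    have [measurable]: "Y (Suc n) \<in> borel_measurable (F m)" "X n \<in> borel_measurable (F m)"
      "Y n \<in> borel_measurable (F m)" "E n \<in> borel_measurable (F m)"
      using that by (auto intro: measurable_F_mono[OF _ Y] measurable_F_mono[OF _ X] measurable_F_mono[OF _ E])
    show ?thesis unfolding ok_def by measurable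
  qed
  have ok_upto_meas: "Measurable.pred (F m) (ok_upto N n)" if "N + n \<le> m" for N n m
    using that
  proof (induction n)
    case (Suc n)
    have "Measurable.pred (F m) (\<lambda>\<omega>. ok_upto N n \<omega>)"
      by (rule Suc.IH) (use Suc.prems in linarith)
    moreover have "Measurable.pred (F m) (\<lambda>\<omega>. ok (N + n) \<omega>)"
      by (rule ok_meas) (use Suc.prems in linarith)
    ultimately show ?case
      unfolding ok_upto_def All_less_Suc by (intro pred_intros_logic(3))
  qed (simp add: ok_upto_def[abs_def])
  have W_meas: "W N n \<in> borel_measurable (F (N + n))" for N n
  proof -
    note Y[of "N + n", measurable] ok_upto_meas[OF order_refl, of N n, measurable]
    show ?thesis unfolding W_def by measurable
  qed
  have W_step: "AE \<omega> in M. nn_cond_exp M (F (N + n)) (W N (Suc n)) \<omega> \<le> W N n \<omega>" for N n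
  proof -
    interpret S: sigma_finite_subalgebra M "F (N + n)" by (rule sigma_finite_subalgebra_F)
    \<comment> \<open>Of the condition \<open>ok (N + n)\<close>, only the half known at time \<open>N + n\<close> may be kept as a factor;
      the pathwise half has served its purpose once \<open>Y\<close> is replaced by \<open>X\<close>.\<close>
    define h where "h \<omega> = (if ok_upto N n \<omega> \<and> E (N + n) \<omega> \<le> Y (N + n) \<omega>
      then 1 else 0 :: ennreal)" for \<omega>
    note Y[of "N + n", measurable] E[of "N + n", measurable]
    note ok_upto_meas[OF order_refl, of N n, measurable]
    have h[measurable]: "h \<in> borel_measurable (F (N + n))"
      unfolding h_def by measurable
    have [measurable]: "h \<in> borel_measurable M" "X (N + n) \<in> borel_measurable M"
      "W N (Suc n) \<in> borel_measurable M"
      by (rule measurable_F_M[OF h], rule measurable_F_M[OF X], rule measurable_F_M[OF W_meas])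
    have "W N (Suc n) \<omega> \<le> h \<omega> * X (N + n) \<omega>" for \<omega>
    proof -
      have "ok_upto N (Suc n) \<omega> \<longleftrightarrow> ok (N + n) \<omega> \<and> ok_upto N n \<omega>"
        by (simp add: ok_upto_def All_less_Suc)
      then show ?thesis by (simp add: W_def h_def ok_def)
    qed
    then have "AE \<omega> in M. nn_cond_exp M (F (N + n)) (W N (Suc n)) \<omega>
        \<le> nn_cond_exp M (F (N + n)) (\<lambda>\<omega>. h \<omega> * X (N + n) \<omega>) \<omega>"
      by (intro S.nn_cond_exp_mono[OF AE_I2]) measurable
    moreover have "AE \<omega> in M. h \<omega> * E (N + n) \<omega>
        = nn_cond_exp M (F (N + n)) (\<lambda>\<omega>. h \<omega> * X (N + n) \<omega>) \<omega>"
      unfolding E_def by (intro S.nn_cond_exp_prod) auto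
    ultimately show ?thesis
    proof eventually_elim
      case (elim \<omega>)
      then show ?case by (auto simp: W_def h_def split: if_splits)
    qed
  qed
  have "AE \<omega> in M. \<forall>N. \<exists>l. (\<lambda>n. W N n \<omega>) \<longlonglongrightarrow> l \<and> (W N 0 \<omega> < \<infinity> \<longrightarrow> l < \<infinity>)"
  proof (intro AE_all_countable[THEN iffD2] allI)
    fix N
    interpret N: discrete_filtration M "\<lambda>n. F (N + n)"
      by unfold_locales (use subalgebra_F F_mono in auto)
    show "AE \<omega> in M. \<exists>l. (\<lambda>n. W N n \<omega>) \<longlonglongrightarrow> l \<and> (W N 0 \<omega> < \<infinity> \<longrightarrow> l < \<infinity>)"
      by (rule N.nonneg_supermartingale_convergence[OF W_meas W_step])
  qed
  with YX XY finite show ?thesis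
  proof eventually_elim
    case (elim \<omega>)
    have "\<forall>\<^sub>F n in sequentially. ok n \<omega>"
      using elim(1,2) by eventually_elim (auto simp: ok_def E_def)
    then obtain N where N: "\<And>n. n \<ge> N \<Longrightarrow> ok n \<omega>"
      by (auto simp: eventually_sequentially)
    then have W: "W N n \<omega> = Y (N + n) \<omega>" for n
      by (simp add: W_def ok_upto_def)
    obtain l where l: "(\<lambda>n. W N n \<omega>) \<longlonglongrightarrow> l" "W N 0 \<omega> < \<infinity> \<longrightarrow> l < \<infinity>"
      using elim(4) by blast
    have "l < \<infinity>" using l(2) elim(3) by (simp add: W)
    have "(\<lambda>n. Y (N + n) \<omega>) \<longlonglongrightarrow> l" using l(1) by (simp add: W)
    then have "(\<lambda>n. Y (n + N) \<omega>) \<longlonglongrightarrow> l"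
      by (simp only: add.commute[of N])
    then have "(\<lambda>n. Y n \<omega>) \<longlonglongrightarrow> l"
      by (rule LIMSEQ_offset)
    with \<open>l < \<infinity>\<close> show ?case by blast
  qed
qed

text \<open>
  The proof normalises with the smallest possible rates \<open>\<beta>' n = (E(X n | F n) - V n) / (1 + V n)\<close>
  instead of \<open>b n\<close>. They are \<open>F n\<close>-measurable by construction, so the product of the \<open>1 + \<beta> k\<close> over
  \<open>k \<le> n\<close> can be taken out of the conditional expectation given \<open>F n\<close>, and they inherit summability
  from \<open>b\<close>. Here \<open>\<beta>\<close> is \<open>\<beta>'\<close> with the value infinity replaced by zero,
  which matters at finitely many times only.
\<close>

lemma robbins_siegmund:
  fixes V X b :: "nat \<Rightarrow> 'a \<Rightarrow> ennreal"
  assumes V: "\<And>n. V n \<in> borel_measurable (F n)" and X: "\<And>n. X n \<in> borel_measurable (F (Suc n))"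
    and VX: "AE \<omega> in M. \<forall>\<^sub>F n in sequentially. V (Suc n) \<omega> \<le> X n \<omega>"
    and XV: "AE \<omega> in M. \<forall>\<^sub>F n in sequentially.
      nn_cond_exp M (F n) (X n) \<omega> \<le> V n \<omega> + b n \<omega> * (1 + V n \<omega>)"
    and b: "AE \<omega> in M. (\<Sum>n. b n \<omega>) < \<infinity>"
    and finite: "AE \<omega> in M. \<forall>n. V n \<omega> < \<infinity>"
  shows "AE \<omega> in M. \<exists>l<\<infinity>. (\<lambda>n. V n \<omega>) \<longlonglongrightarrow> l"
proof -
  define E where "E n = nn_cond_exp M (F n) (X n)" for n
  define \<beta>' where "\<beta>' n \<omega> = (E n \<omega> - V n \<omega>) / (1 + V n \<omega>)" for n \<omega>
  define \<beta> where "\<beta> n \<omega> = enn2real (\<beta>' n \<omega>)" for n \<omega>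
  define p where "p n \<omega> = (\<Prod>k<n. 1 + \<beta> k \<omega>)" for n \<omega>
  define Y where "Y n \<omega> = ennreal (1 / p n \<omega>) * (1 + V n \<omega>)" for n \<omega>
  define X' where "X' n \<omega> = ennreal (1 / p (Suc n) \<omega>) * (1 + X n \<omega>)" for n \<omega>
  have \<beta>_nonneg: "\<beta> n \<omega> \<ge> 0" for n \<omega>
    by (simp add: \<beta>_def)
  have p_ge_1: "p n \<omega> \<ge> 1" for n \<omega>
    unfolding p_def by (intro prod_ge_1) (simp add: \<beta>_nonneg)
  have \<beta>_meas: "\<beta> n \<in> borel_measurable (F n)" for n
  proof -
    note V[of n, measurable]
    have [measurable]: "E n \<in> borel_measurable (F n)" by (simp add: E_def)
    show ?thesis unfolding \<beta>_def \<beta>'_def by measurable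
  qed
  have p_meas: "p n \<in> borel_measurable (F m)" if "n \<le> Suc m" for n m
    unfolding p_def using that
    by (intro borel_measurable_prod borel_measurable_add measurable_F_mono[OF _ \<beta>_meas]) auto
  have Y_meas: "Y n \<in> borel_measurable (F n)" for n
  proof -
    note V[of n, measurable] p_meas[of n n, simplified, measurable]
    show ?thesis unfolding Y_def by measurable
  qed
  have X'_meas: "X' n \<in> borel_measurable (F (Suc n))" for n
  proof -
    note X[of n, measurable] p_meas[of "Suc n" "Suc n", simplified, measurable]
    show ?thesis unfolding X'_def by measurable
  qed
  have cond: "AE \<omega> in M. \<forall>n. nn_cond_exp M (F n) (X' n) \<omega> = ennreal (1 / p (Suc n) \<omega>) * (1 + E n \<omega>)"
  proof (intro AE_all_countable[THEN iffD2] allI)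
    fix n
    interpret S: sigma_finite_subalgebra M "F n" by (rule sigma_finite_subalgebra_F)
    note p_meas[of "Suc n" n, simplified, measurable]
    have [measurable]: "X n \<in> borel_measurable M"
      using X measurable_F_M by blast
    have "AE \<omega> in M. ennreal (1 / p (Suc n) \<omega>) * nn_cond_exp M (F n) (\<lambda>\<omega>. 1 + X n \<omega>) \<omega>
        = nn_cond_exp M (F n) (X' n) \<omega>"
      unfolding X'_def by (intro S.nn_cond_exp_prod) auto
    moreover have "AE \<omega> in M. nn_cond_exp M (F n) (\<lambda>_. 1) \<omega> + nn_cond_exp M (F n) (X n) \<omega>
        = nn_cond_exp M (F n) (\<lambda>\<omega>. 1 + X n \<omega>) \<omega>"
      by (intro S.nn_cond_exp_sum) auto
    moreover have "AE \<omega> in M. 1 = nn_cond_exp M (F n) (\<lambda>_. 1) \<omega>"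
      by (intro S.nn_cond_exp_F_meas) auto
    ultimately show "AE \<omega> in M. nn_cond_exp M (F n) (X' n) \<omega> = ennreal (1 / p (Suc n) \<omega>) * (1 + E n \<omega>)"
      by eventually_elim (simp add: E_def)
  qed
  have \<beta>'_le: "AE \<omega> in M. \<forall>\<^sub>F n in sequentially. \<beta>' n \<omega> \<le> b n \<omega>"
    using XV finite
  proof eventually_elim
    case (elim \<omega>)
    from elim(1) show ?case
    proof eventually_elim
      case (elim n)
      have "E n \<omega> - V n \<omega> \<le> b n \<omega> * (1 + V n \<omega>)"
        using elim \<open>\<forall>n. V n \<omega> < \<infinity>\<close> unfolding E_def
        by (metis add.commute ennreal_minus_le_iff infinity_ennreal_def order_less_irrefl)
      then show ?case
        unfolding \<beta>'_def by (intro divide_le_posI_ennreal) (auto simp: add_pos_nonneg mult.commute)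
    qed
  qed
  have b_finite: "AE \<omega> in M. \<forall>n. b n \<omega> < \<infinity>"
    using b by eventually_elim (rule ennreal_suminf_finite_imp_terms_finite)
  have \<beta>_eq: "AE \<omega> in M. \<forall>\<^sub>F n in sequentially. ennreal (\<beta> n \<omega>) = \<beta>' n \<omega>"
    using \<beta>'_le b_finite
  proof eventually_elim
    case (elim \<omega>)
    from elim(1) show ?case
    proof eventually_elim
      case (elim n)
      then have "\<beta>' n \<omega> < \<infinity>" using \<open>\<forall>n. b n \<omega> < \<infinity>\<close> le_less_trans by blast
      then show ?case by (simp add: \<beta>_def)
    qed
  qed
  have p_conv: "AE \<omega> in M. \<exists>q\<ge>1. (\<lambda>n. p n \<omega>) \<longlonglongrightarrow> q"
    using \<beta>'_le b b_finite \<beta>_eq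
  proof eventually_elim
    case (elim \<omega>)
    have eq: "ennreal (enn2real (b n \<omega>)) = b n \<omega>" for n
      using elim(3) by simp
    have "summable (\<lambda>n. enn2real (b n \<omega>))"
      by (rule summable_suminf_not_top) (use elim(2) in \<open>auto simp: eq\<close>)
    moreover have "\<forall>\<^sub>F n in sequentially. norm \<bar>\<beta> n \<omega>\<bar> \<le> enn2real (b n \<omega>)"
      using elim(1,4)
    proof eventually_elim
      case (elim n)
      then have "ennreal (\<beta> n \<omega>) \<le> ennreal (enn2real (b n \<omega>))" by (simp add: eq)
      then show ?case by (simp add: \<beta>_nonneg)
    qed
    ultimately have "summable (\<lambda>n. \<bar>\<beta> n \<omega>\<bar>)"
      by (rule summable_comparison_test_ev[rotated])
    then have "convergent_prod (\<lambda>n. 1 + \<beta> n \<omega>)"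
      by (rule summable_imp_convergent_prod_real) (metis \<beta>_nonneg add.inverse_inverse neg_0_le_iff_le not_one_le_zero)
    then have "convergent (\<lambda>n. \<Prod>k\<le>n. 1 + \<beta> k \<omega>)"
      by (rule convergent_prod_imp_convergent)
    then obtain q where "(\<lambda>n. p (Suc n) \<omega>) \<longlonglongrightarrow> q"
      unfolding p_def lessThan_Suc_atMost by (auto simp: convergent_def)
    then have q: "(\<lambda>n. p n \<omega>) \<longlonglongrightarrow> q" by (rule LIMSEQ_imp_Suc)
    then have "q \<ge> 1"
      by (rule LIMSEQ_le_const) (use p_ge_1 in auto)
    with q show ?case by blast
  qed
  have "AE \<omega> in M. \<exists>l<\<infinity>. (\<lambda>n. Y n \<omega>) \<longlonglongrightarrow> l"
  proof (rule eventual_supermartingale_convergence[OF Y_meas X'_meas])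
    show "AE \<omega> in M. \<forall>\<^sub>F n in sequentially. Y (Suc n) \<omega> \<le> X' n \<omega>"
      using VX by eventually_elim
        (auto elim!: eventually_mono simp: Y_def X'_def intro!: mult_left_mono add_left_mono)
    show "AE \<omega> in M. \<forall>n. Y n \<omega> < \<infinity>"
      using finite by eventually_elim (auto simp: Y_def ennreal_mult_less_top)
    show "AE \<omega> in M. \<forall>\<^sub>F n in sequentially. nn_cond_exp M (F n) (X' n) \<omega> \<le> Y n \<omega>"
      using \<beta>_eq cond finite
    proof eventually_elim
      case (elim \<omega>)
      note fin = elim(3) and cond = elim(2)
      from elim(1) show ?case
      proof eventually_elim
        case (elim n)
        let ?w = "1 + V n \<omega>"
        have w: "?w \<noteq> 0" "?w < \<infinity>" using fin by (auto simp: less_top[symmetric])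
        have "E n \<omega> \<le> V n \<omega> + (E n \<omega> - V n \<omega>)"
          by (metis add_diff_inverse_ennreal diff_eq_0_ennreal linorder_le_cases order_refl add_increasing2 zero_le)
        then have "1 + E n \<omega> \<le> 1 + (V n \<omega> + (E n \<omega> - V n \<omega>))"
          by (rule add_left_mono)
        also have "E n \<omega> - V n \<omega> = \<beta>' n \<omega> * ?w"
          using w unfolding \<beta>'_def
          by (simp add: ennreal_divide_times ennreal_divide_self)
        also have "1 + (V n \<omega> + \<beta>' n \<omega> * ?w) = ?w * ennreal (1 + \<beta> n \<omega>)"
          using elim by (simp add: \<beta>_nonneg algebra_simps)
        finally have "1 + E n \<omega> \<le> ?w * ennreal (1 + \<beta> n \<omega>)" .
        then have "ennreal (1 / p (Suc n) \<omega>) * (1 + E n \<omega>)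
            \<le> ennreal (1 / p (Suc n) \<omega>) * (?w * ennreal (1 + \<beta> n \<omega>))"
          by (rule mult_left_mono) simp
        also have "\<dots> = ennreal (1 / p (Suc n) \<omega> * (1 + \<beta> n \<omega>)) * ?w"
          using p_ge_1[of "Suc n" \<omega>] \<beta>_nonneg[of n \<omega>] by (subst ennreal_mult) (auto simp: ac_simps)
        also have "1 / p (Suc n) \<omega> * (1 + \<beta> n \<omega>) = 1 / p n \<omega>"
          using \<beta>_nonneg[of n \<omega>] by (simp add: p_def)
        finally show ?case using cond by (simp add: Y_def)
      qed
    qed
  qed
  with p_conv show ?thesis
  proof eventually_elim
    case (elim \<omega>)
    then obtain q l where q: "q \<ge> 1" "(\<lambda>n. p n \<omega>) \<longlonglongrightarrow> q" and l: "l < \<infinity>" "(\<lambda>n. Y n \<omega>) \<longlonglongrightarrow> l"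
      by blast
    have "(\<lambda>n. ennreal (p n \<omega>) * Y n \<omega> - 1) \<longlonglongrightarrow> ennreal q * l - 1"
      using q l by (intro tendsto_diff_ennreal_general tendsto_mult_ennreal tendsto_ennrealI tendsto_const) auto
    moreover have "ennreal (p n \<omega>) * Y n \<omega> - 1 = V n \<omega>" for n
    proof -
      have "ennreal (p n \<omega>) * ennreal (1 / p n \<omega>) = 1"
        using p_ge_1[of n \<omega>] by (subst ennreal_mult[symmetric]) auto
      then show ?thesis unfolding Y_def by (simp add: mult.assoc[symmetric])
    qed
    moreover have "ennreal q * l - 1 < \<infinity>"
      using l by (metis diff_le_self_ennreal ennreal_less_top ennreal_mult_less_top infinity_ennreal_def le_less_trans)
    ultimately show ?case by auto
  qed
qed

end

section \<open>Measurability of compositions\<close>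

text \<open>
  A Caratheodory function may be composed with a measurable map: for a simple function \<open>s i\<close> the
  composition is pieced together from finitely many sections, and continuity allows the
  passage to the limit. It is applied to the projections onto the random sets, which are
  known to be measurable for a fixed point only.
\<close>

lemma borel_measurable_caratheodory:
  fixes f :: "'a \<Rightarrow> 'b :: {metric_space, second_countable_topology} \<Rightarrow> 'c :: metric_space"
  assumes meas: "\<And>z. (\<lambda>\<omega>. f \<omega> z) \<in> borel_measurable N"
    and cont: "\<And>\<omega>. \<omega> \<in> space N \<Longrightarrow> continuous_on UNIV (f \<omega>)"
    and X: "X \<in> borel_measurable N"
  shows "(\<lambda>\<omega>. f \<omega> (X \<omega>)) \<in> borel_measurable N"
proof -
  from borel_measurable_implies_sequence_metric[OF X, of undefined] obtain s where
    s: "\<And>i. simple_function N (s i)" "\<And>\<omega>. \<omega> \<in> space N \<Longrightarrow> (\<lambda>i. s i \<omega>) \<longlonglongrightarrow> X \<omega>"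
    by blast
  have 1: "(\<lambda>\<omega>. f \<omega> (s i \<omega>)) \<in> borel_measurable N" for i
  proof (rule measurable_compose_countable'[where f = "\<lambda>z \<omega>. f \<omega> z"])
    show "s i \<in> measurable N (count_space (s i ` space N))"
      using s(1)[of i] by (auto simp: simple_function_def measurable_count_space_eq2)
    show "countable (s i ` space N)"
      using s(1)[of i] by (auto simp: simple_function_def intro: countable_finite)
  qed (rule meas)
  have "(\<lambda>i. f \<omega> (s i \<omega>)) \<longlonglongrightarrow> f \<omega> (X \<omega>)" if "\<omega> \<in> space N" for \<omega>
    using continuous_on_tendsto_compose[OF cont[OF that] s(2)[OF that]] by simp
  with 1 show ?thesis by (rule borel_measurable_LIMSEQ_metric)
qed

lemma borel_measurable_matrix_vector_mult:
  fixes A :: "'a \<Rightarrow> real^'n^'m"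
  assumes "A \<in> borel_measurable N" "x \<in> borel_measurable N"
  shows "(\<lambda>\<omega>. A \<omega> *v x \<omega>) \<in> borel_measurable N"
  using assms
  by (rule borel_measurable_continuous_Pair) (auto simp: matrix_vector_mult_def intro!: continuous_intros)

lemma borel_measurable_transpose:
  fixes A :: "'a \<Rightarrow> real^'n^'m"
  assumes "A \<in> borel_measurable N"
  shows "(\<lambda>\<omega>. transpose (A \<omega>)) \<in> borel_measurable N"
  by (rule borel_measurable_continuous_on[OF _ assms]) (auto simp: transpose_def intro!: continuous_intros)

section \<open>Extreme eigenvalues of a symmetric matrix\<close>

text \<open>
  For symmetric \<open>A\<close> this is the largest eigenvalue (\<open>lambda_max_eq_rayleigh_sup\<close>). In this form,
  and for all matrices, it is seen to be a Borel function of \<open>A\<close>, as its sublevel sets are intersections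
  of closed half-spaces. Measurability in \<open>\<omega>\<close> is needed to take the largest eigenvalue of \<open>C\<^sub>t\<close>
  out of a conditional expectation.
\<close>

definition rayleigh_sup :: "real^'m^'m \<Rightarrow> real" where
  "rayleigh_sup A = (SUP x\<in>sphere 0 1. x \<bullet> (A *v x))"

lemma continuous_on_quadratic_form: "continuous_on S (\<lambda>x. x \<bullet> ((A::real^'m^'m) *v x))"
  by (auto intro!: continuous_intros matrix_vector_mult_linear_continuous_on)

lemma sphere_nonempty: "sphere (0::real^'m) 1 \<noteq> {}"
  using vector_choose_size[of 1] by (auto simp: sphere_def dist_norm)

lemma rayleigh_sup_attained:
  fixes A :: "real^'m^'m"
  obtains x where "norm x = 1" "x \<bullet> (A *v x) = rayleigh_sup A"
    "\<And>y. y \<bullet> (A *v y) \<le> rayleigh_sup A * (norm y)\<^sup>2"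
proof -
  obtain x where x: "x \<in> sphere 0 1" "\<And>y. y \<in> sphere 0 1 \<Longrightarrow> y \<bullet> (A *v y) \<le> x \<bullet> (A *v x)"
    using continuous_attains_sup[OF compact_sphere sphere_nonempty continuous_on_quadratic_form] by blast
  then have eq: "rayleigh_sup A = x \<bullet> (A *v x)"
    unfolding rayleigh_sup_def by (intro cSup_eq_maximum) auto
  have "y \<bullet> (A *v y) \<le> rayleigh_sup A * (norm y)\<^sup>2" for y
  proof (cases "y = 0")
    case False
    define u where "u = y /\<^sub>R norm y"
    have u: "norm u = 1" "norm y *\<^sub>R u = y"
      using False by (auto simp: u_def)
    have "(norm y *\<^sub>R u) \<bullet> (A *v (norm y *\<^sub>R u)) = (norm y)\<^sup>2 * (u \<bullet> (A *v u))"
      by (simp add: matrix_vector_mult_scaleR power2_eq_square)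
    also have "\<dots> \<le> (norm y)\<^sup>2 * rayleigh_sup A"
      using x(2)[of u] u(1) unfolding eq by (intro mult_left_mono) auto
    finally show ?thesis by (simp add: u(2) mult.commute)
  qed simp
  then show ?thesis using that[of x] x(1) eq by simp
qed

lemma borel_measurable_rayleigh_sup: "rayleigh_sup \<in> borel_measurable borel"
proof (rule borel_measurableI_le)
  fix c
  have "rayleigh_sup A \<le> c \<longleftrightarrow> (\<forall>x\<in>sphere 0 1. x \<bullet> (A *v x) \<le> c)" for A :: "real^'m^'m"
    unfolding rayleigh_sup_def
    by (intro cSUP_le_iff sphere_nonempty compact_imp_bounded[THEN bounded_imp_bdd_above]
        compact_continuous_image compact_sphere continuous_on_quadratic_form)
  then have "{A :: real^'m^'m. rayleigh_sup A \<le> c} = (\<Inter>x\<in>sphere 0 1. {A. x \<bullet> (A *v x) \<le> c})"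
    by auto
  also have "closed \<dots>"
    by (intro closed_INT ballI closed_Collect_le) (auto simp: matrix_vector_mult_def intro!: continuous_intros)
  finally show "{A \<in> space borel. rayleigh_sup (A :: real^'m^'m) \<le> c} \<in> sets borel"
    using borel_closed by simp
qed

lemma inner_matrix_symmetric:
  fixes A :: "real^'m^'m"
  assumes "transpose A = A"
  shows "x \<bullet> (A *v y) = y \<bullet> (A *v x)"
  using dot_lmul_matrix[of x A y] assms by (metis inner_commute transpose_matrix_vector)

text \<open>
  Perturb \<open>x\<close> in the direction \<open>- B x\<close>: to first order the form changes by \<open>- 2 s \<parallel>B x\<parallel>\<^sup>2\<close>, which
  positivity forbids for small \<open>s\<close> unless \<open>B x = 0\<close>.
\<close>

lemma psd_null_form_imp_null:
  fixes B :: "real^'m^'m"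
  assumes sym: "transpose B = B" and psd: "\<And>y. 0 \<le> y \<bullet> (B *v y)" and null: "x \<bullet> (B *v x) = 0"
  shows "B *v x = 0"
proof -
  define y where "y = B *v x"
  define a where "a = y \<bullet> (B *v y)"
  have *: "0 \<le> s * (s * a - 2 * (y \<bullet> y))" for s
  proof -
    have "0 \<le> (x - s *\<^sub>R y) \<bullet> (B *v (x - s *\<^sub>R y))" by (rule psd)
    also have "\<dots> = s * (s * a - 2 * (y \<bullet> y))"
      using null inner_matrix_symmetric[OF sym, of x y]
      by (simp add: matrix_vector_mult_diff_distrib matrix_vector_mult_scaleR inner_diff_left inner_diff_right
          y_def[symmetric] a_def algebra_simps)
    finally show ?thesis .
  qed
  have "a \<ge> 0" using psd by (simp add: a_def)
  define s where "s = (y \<bullet> y) / (1 + a)"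
  have "s \<ge> 0" "s * a \<le> y \<bullet> y"
    using \<open>a \<ge> 0\<close> by (auto simp: s_def field_simps)
  then have "s * (s * a - 2 * (y \<bullet> y)) \<le> s * (- (y \<bullet> y))"
    by (intro mult_left_mono) auto
  then have "s * (y \<bullet> y) \<le> 0" using *[of s] by simp
  then have "y \<bullet> y \<le> 0"
    using \<open>a \<ge> 0\<close> by (auto simp: s_def divide_le_0_iff mult_le_0_iff)
  then show ?thesis unfolding y_def by (metis inner_ge_zero inner_eq_zero_iff order_antisym)
qed

text \<open>
  At a unit vector where the Rayleigh quotient is maximal, the positive semidefinite form of
  \<open>\<lambda> I - A\<close> vanishes.
\<close>

lemma rayleigh_sup_eigenvalue:
  fixes A :: "real^'m^'m"
  assumes sym: "transpose A = A"
  shows "rayleigh_sup A \<in> eigenvalues A"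
proof -
  obtain x where x: "norm x = 1" "x \<bullet> (A *v x) = rayleigh_sup A"
    "\<And>y. y \<bullet> (A *v y) \<le> rayleigh_sup A * (norm y)\<^sup>2"
    using rayleigh_sup_attained by blast
  define B where "B = rayleigh_sup A *\<^sub>R mat 1 - A"
  have B: "B *v y = rayleigh_sup A *\<^sub>R y - A *v y" for y
    by (simp add: B_def matrix_vector_mult_diff_rdistrib scaleR_matrix_vector_assoc[symmetric])
  have "B *v x = 0"
  proof (rule psd_null_form_imp_null)
    show "transpose B = B"
      using sym by (simp add: B_def transpose_def mat_def vec_eq_iff)
    show "0 \<le> y \<bullet> (B *v y)" for y
      using x(3)[of y] by (simp add: B inner_diff_right power2_norm_eq_inner)
    show "x \<bullet> (B *v x) = 0"
      using x(1,2) by (simp add: B inner_diff_right flip: power2_norm_eq_inner)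
  qed
  then have "A *v x = rayleigh_sup A *\<^sub>R x" by (simp add: B)
  moreover have "x \<noteq> 0" using x(1) by auto
  ultimately show ?thesis by (auto simp: eigenvalues_def)
qed

text \<open>
  Eigenvectors of distinct eigenvalues are orthogonal, hence independent. Finiteness is what
  makes \<^const>\<open>Max\<close> and \<^const>\<open>Min\<close> in the definitions of the extreme eigenvalues meaningful.
\<close>

lemma finite_eigenvalues:
  fixes A :: "real^'m^'m"
  assumes sym: "transpose A = A"
  shows "finite (eigenvalues A)"
proof -
  define v where "v l = (SOME v. v \<noteq> 0 \<and> A *v v = l *\<^sub>R v)" for l
  have v: "v l \<noteq> 0" "A *v v l = l *\<^sub>R v l" if "l \<in> eigenvalues A" for l
    using someI_ex[of "\<lambda>v. v \<noteq> 0 \<and> A *v v = l *\<^sub>R v"] that by (auto simp: eigenvalues_def v_def)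
  have orth: "v k \<bullet> v l = 0" if "k \<in> eigenvalues A" "l \<in> eigenvalues A" "k \<noteq> l" for k l
    using inner_matrix_symmetric[OF sym, of "v k" "v l"] v that by (simp add: inner_commute)
  have inj: "inj_on v (eigenvalues A)"
    using orth v by (auto intro!: inj_onI) (metis inner_eq_zero_iff)
  have "pairwise orthogonal (v ` eigenvalues A)"
    using orth by (auto simp: pairwise_def orthogonal_def)
  then have "independent (v ` eigenvalues A)"
    using v by (intro pairwise_orthogonal_independent) auto
  then have "finite (v ` eigenvalues A)"
    by (rule independent_imp_finite)
  then show ?thesis using inj by (rule finite_imageD)
qed

lemma lambda_max_eq_rayleigh_sup:
  fixes A :: "real^'m^'m"
  assumes sym: "transpose A = A"
  shows "lambda_max A = rayleigh_sup A"
  unfolding lambda_max_def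
proof (rule Max_eqI)
  fix l assume "l \<in> eigenvalues A"
  then obtain v where v: "v \<noteq> 0" "A *v v = l *\<^sub>R v" by (auto simp: eigenvalues_def)
  obtain x where "\<And>y. y \<bullet> (A *v y) \<le> rayleigh_sup A * (norm y)\<^sup>2"
    using rayleigh_sup_attained by blast
  from this[of v] v show "l \<le> rayleigh_sup A"
    by (simp add: power2_norm_eq_inner)
qed (use sym finite_eigenvalues rayleigh_sup_eigenvalue in auto)

lemma quadratic_form_le_lambda_max:
  assumes "transpose A = A"
  shows "x \<bullet> (A *v x) \<le> lambda_max A * (norm x)\<^sup>2"
  unfolding lambda_max_eq_rayleigh_sup[OF assms] by (rule rayleigh_sup_attained)

lemma lambda_min_le_quadratic_form:
  fixes A :: "real^'m^'m"
  assumes sym: "transpose A = A"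
  shows "lambda_min A * (norm x)\<^sup>2 \<le> x \<bullet> (A *v x)"
proof -
  have neg: "(- A) *v y = - (A *v y)" for y
    using matrix_vector_mult_diff_rdistrib[of 0 A y] by simp
  have "transpose (- A) = - A"
    using sym by (simp add: transpose_def vec_eq_iff)
  note rayleigh_sup_eigenvalue[OF this]
  then have "- rayleigh_sup (- A) \<in> eigenvalues A"
    by (auto simp: eigenvalues_def neg) (metis minus_equation_iff scaleR_minus_left)
  then have "lambda_min A \<le> - rayleigh_sup (- A)"
    unfolding lambda_min_def by (intro Min_le finite_eigenvalues sym)
  then have "lambda_min A * (norm x)\<^sup>2 \<le> - rayleigh_sup (- A) * (norm x)\<^sup>2"
    by (intro mult_right_mono) auto
  also have "x \<bullet> ((- A) *v x) \<le> rayleigh_sup (- A) * (norm x)\<^sup>2"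
    by (rule rayleigh_sup_attained)
  then have "- rayleigh_sup (- A) * (norm x)\<^sup>2 \<le> x \<bullet> (A *v x)"
    by (simp add: neg)
  finally show ?thesis .
qed

lemma sym_pos_def_eigenvalues_pos:
  assumes "sym_pos_def A" "l \<in> eigenvalues A"
  shows "l > 0"
proof -
  obtain v where v: "v \<noteq> 0" "A *v v = l *\<^sub>R v" using assms(2) by (auto simp: eigenvalues_def)
  with assms(1) have "0 < l * (v \<bullet> v)" by (auto simp: sym_pos_def_def dest!: spec[of _ v])
  then show ?thesis by (metis inner_ge_zero not_less zero_less_mult_pos2 mult_nonpos_nonneg)
qed

lemma lambda_pos:
  assumes "sym_pos_def A"
  shows "lambda_min A > 0" "lambda_max A > 0"
proof -
  have sym: "transpose A = A" using assms by (simp add: sym_pos_def_def)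
  have ne: "eigenvalues A \<noteq> {}" using rayleigh_sup_eigenvalue[OF sym] by blast
  have "lambda_min A \<in> eigenvalues A" "lambda_max A \<in> eigenvalues A"
    unfolding lambda_min_def lambda_max_def
    using Min_in Max_in finite_eigenvalues[OF sym] ne by blast+
  then show "lambda_min A > 0" "lambda_max A > 0"
    using sym_pos_def_eigenvalues_pos[OF assms] by blast+
qed

lemma sym_pos_def_nonneg: "sym_pos_def A \<Longrightarrow> 0 \<le> x \<bullet> (A *v x)"
  by (cases "x = 0") (auto simp: sym_pos_def_def intro: less_imp_le)

section \<open>Conditional expectation of an affine function plus a nonnegative term\<close>

context sigma_finite_subalgebra
begin

lemma nn_cond_exp_finite_sum:
  fixes f :: "'i \<Rightarrow> 'a \<Rightarrow> ennreal"
  assumes "finite I" "\<And>i. i \<in> I \<Longrightarrow> f i \<in> borel_measurable M"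
  shows "AE x in M. nn_cond_exp M F (\<lambda>x. \<Sum>i\<in>I. f i x) x = (\<Sum>i\<in>I. nn_cond_exp M F (f i) x)"
  using assms
proof (induction I)
  case empty
  have "AE x in M. 0 = nn_cond_exp M F (\<lambda>_. 0) x" by (rule nn_cond_exp_F_meas) simp
  then show ?case by eventually_elim simp
next
  case (insert i I)
  have "AE x in M. nn_cond_exp M F (f i) x + nn_cond_exp M F (\<lambda>x. \<Sum>i\<in>I. f i x) x
      = nn_cond_exp M F (\<lambda>x. f i x + (\<Sum>i\<in>I. f i x)) x"
    using insert by (intro nn_cond_exp_sum borel_measurable_sum) auto
  moreover have "AE x in M. nn_cond_exp M F (\<lambda>x. \<Sum>i\<in>I. f i x) x = (\<Sum>i\<in>I. nn_cond_exp M F (f i) x)"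
    using insert by auto
  ultimately show ?case
    by eventually_elim (use insert in simp)
qed

text \<open>
  The difficulty is that \<open>h\<^sup>T f\<close> has no fixed sign and is in general not integrable. With \<open>h\<^sub>i f\<^sub>i = (h\<^sub>i\<^sup>+ f\<^sub>i\<^sup>+ + h\<^sub>i\<^sup>- f\<^sub>i\<^sup>-) - (h\<^sub>i\<^sup>+ f\<^sub>i\<^sup>- + h\<^sub>i\<^sup>- f\<^sub>i\<^sup>+)\<close>, the negative parts are moved to the
  left-hand side; both sides are then sums of nonnegative terms, to which the conditional
  expectation applies term by term. The resulting quantities are almost surely finite, so that
  the equation can be solved for the wanted one in the reals.
\<close>

lemma nn_cond_exp_affine:
  fixes f g h :: "'a \<Rightarrow> real^'m" and c q :: "'a \<Rightarrow> real"
  assumes fg: "is_cond_exp M F f g"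
    and c[measurable]: "c \<in> borel_measurable F" and h[measurable]: "h \<in> borel_measurable F"
    and q[measurable]: "q \<in> borel_measurable M"
    and c_nonneg: "AE x in M. 0 \<le> c x" and q_nonneg: "AE x in M. 0 \<le> q x"
    and nonneg: "AE x in M. 0 \<le> c x + h x \<bullet> f x + q x"
    and q_finite: "AE x in M. nn_cond_exp M F (\<lambda>x. ennreal (q x)) x < \<infinity>"
  shows "AE x in M. nn_cond_exp M F (\<lambda>x. ennreal (c x + h x \<bullet> f x + q x)) x
    = ennreal (c x + h x \<bullet> g x + enn2real (nn_cond_exp M F (\<lambda>x. ennreal (q x)) x))"
proof -
  let ?E = "nn_cond_exp M F"
  have f[measurable]: "f \<in> borel_measurable M"
    using fg by (simp add: is_cond_exp_def)
  have cM[measurable]: "c \<in> borel_measurable M" and hM[measurable]: "h \<in> borel_measurable M"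
    by (rule measurable_from_subalg[OF subalg c], rule measurable_from_subalg[OF subalg h])
  define hp hm where "hp i x = ennreal (h x $ i)" and "hm i x = ennreal (- (h x $ i))" for i x
  define fp fm where "fp i x = ennreal (f x $ i)" and "fm i x = ennreal (- (f x $ i))" for i x
  have comp: "(\<lambda>x. y x $ i) \<in> borel_measurable N" if "y \<in> borel_measurable N" for y :: "'a \<Rightarrow> real^'m" and i N
    using that by (simp add: cart_eq_inner_axis)
  note comp[OF h, measurable] comp[OF hM, measurable] comp[OF f, measurable]
  define X where "X x = ennreal (c x + h x \<bullet> f x + q x)" for x
  have [measurable]: "hp i \<in> borel_measurable F" "hm i \<in> borel_measurable F"
    "hp i \<in> borel_measurable M" "hm i \<in> borel_measurable M"
    "fp i \<in> borel_measurable M" "fm i \<in> borel_measurable M" for i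
    unfolding hp_def hm_def fp_def fm_def by measurable
  have [measurable]: "X \<in> borel_measurable M"
    unfolding X_def by measurable
  have split: "AE x in M. X x + (\<Sum>i\<in>UNIV. hp i x * fm i x + hm i x * fp i x)
      = ennreal (c x) + (\<Sum>i\<in>UNIV. hp i x * fp i x + hm i x * fm i x) + ennreal (q x)"
    using c_nonneg q_nonneg nonneg
  proof eventually_elim
    case (elim x)
    let ?n = "\<lambda>i. max 0 (h x $ i) * max 0 (- (f x $ i)) + max 0 (- (h x $ i)) * max 0 (f x $ i)"
    let ?p = "\<lambda>i. max 0 (h x $ i) * max 0 (f x $ i) + max 0 (- (h x $ i)) * max 0 (- (f x $ i))"
    have e: "ennreal t = ennreal (max 0 t)" for t by (simp add: max_def ennreal_neg)
    have n: "hp i x * fm i x + hm i x * fp i x = ennreal (?n i)" for i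
      unfolding hp_def hm_def fp_def fm_def e[of "h x $ i"] e[of "- (h x $ i)"] e[of "f x $ i"] e[of "- (f x $ i)"]
      by (simp add: ennreal_mult ennreal_plus)
    have p: "hp i x * fp i x + hm i x * fm i x = ennreal (?p i)" for i
      unfolding hp_def hm_def fp_def fm_def e[of "h x $ i"] e[of "- (h x $ i)"] e[of "f x $ i"] e[of "- (f x $ i)"]
      by (simp add: ennreal_mult ennreal_plus)
    have "h x \<bullet> f x + (\<Sum>i\<in>UNIV. ?n i) = (\<Sum>i\<in>UNIV. ?p i)"
      unfolding inner_vec_def sum.distrib[symmetric]
      by (intro sum.cong) (auto simp: max_def algebra_simps)
    then have "c x + h x \<bullet> f x + q x + (\<Sum>i\<in>UNIV. ?n i) = c x + (\<Sum>i\<in>UNIV. ?p i) + q x" by simp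
    moreover have "0 \<le> ?n i" "0 \<le> ?p i" for i by auto
    ultimately show ?case
      using elim unfolding n p X_def
      by (simp add: sum_ennreal ennreal_plus[symmetric] sum_nonneg del: ennreal_plus)
  qed
  have prods: "AE x in M. \<forall>i. ?E (\<lambda>x. hp i x * fm i x + hm i x * fp i x) x = hp i x * ?E (fm i) x + hm i x * ?E (fp i) x \<and>
      ?E (\<lambda>x. hp i x * fp i x + hm i x * fm i x) x = hp i x * ?E (fp i) x + hm i x * ?E (fm i) x"
  proof (intro AE_all_countable[THEN iffD2] allI)
    fix i
    have "AE x in M. hp i x * ?E (fm i) x = ?E (\<lambda>x. hp i x * fm i x) x"
      "AE x in M. hm i x * ?E (fp i) x = ?E (\<lambda>x. hm i x * fp i x) x"
      "AE x in M. hp i x * ?E (fp i) x = ?E (\<lambda>x. hp i x * fp i x) x"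
      "AE x in M. hm i x * ?E (fm i) x = ?E (\<lambda>x. hm i x * fm i x) x"
      by (intro nn_cond_exp_prod; measurable)+
    moreover have
      "AE x in M. ?E (\<lambda>x. hp i x * fm i x) x + ?E (\<lambda>x. hm i x * fp i x) x = ?E (\<lambda>x. hp i x * fm i x + hm i x * fp i x) x"
      "AE x in M. ?E (\<lambda>x. hp i x * fp i x) x + ?E (\<lambda>x. hm i x * fm i x) x = ?E (\<lambda>x. hp i x * fp i x + hm i x * fm i x) x"
      by (intro nn_cond_exp_sum; measurable)+
    ultimately show "AE x in M. ?E (\<lambda>x. hp i x * fm i x + hm i x * fp i x) x = hp i x * ?E (fm i) x + hm i x * ?E (fp i) x \<and>
      ?E (\<lambda>x. hp i x * fp i x + hm i x * fm i x) x = hp i x * ?E (fp i) x + hm i x * ?E (fm i) x"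
      by eventually_elim simp
  qed
  have lhs: "AE x in M. ?E (\<lambda>x. X x + (\<Sum>i\<in>UNIV. hp i x * fm i x + hm i x * fp i x)) x
      = ?E X x + (\<Sum>i\<in>UNIV. ?E (\<lambda>x. hp i x * fm i x + hm i x * fp i x) x)"
  proof -
    have "AE x in M. ?E X x + ?E (\<lambda>x. \<Sum>i\<in>UNIV. hp i x * fm i x + hm i x * fp i x) x
        = ?E (\<lambda>x. X x + (\<Sum>i\<in>UNIV. hp i x * fm i x + hm i x * fp i x)) x"
      by (rule nn_cond_exp_sum; measurable)
    moreover have "AE x in M. ?E (\<lambda>x. \<Sum>i\<in>UNIV. hp i x * fm i x + hm i x * fp i x) x
        = (\<Sum>i\<in>UNIV. ?E (\<lambda>x. hp i x * fm i x + hm i x * fp i x) x)"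
      by (rule nn_cond_exp_finite_sum) auto
    ultimately show ?thesis by eventually_elim simp
  qed
  have rhs: "AE x in M. ?E (\<lambda>x. ennreal (c x) + (\<Sum>i\<in>UNIV. hp i x * fp i x + hm i x * fm i x) + ennreal (q x)) x
      = ennreal (c x) + (\<Sum>i\<in>UNIV. ?E (\<lambda>x. hp i x * fp i x + hm i x * fm i x) x) + ?E (\<lambda>x. ennreal (q x)) x"
  proof -
    have "AE x in M. ?E (\<lambda>x. ennreal (c x)) x + ?E (\<lambda>x. \<Sum>i\<in>UNIV. hp i x * fp i x + hm i x * fm i x) x
        = ?E (\<lambda>x. ennreal (c x) + (\<Sum>i\<in>UNIV. hp i x * fp i x + hm i x * fm i x)) x"
      by (rule nn_cond_exp_sum; measurable)
    moreover have "AE x in M. ?E (\<lambda>x. ennreal (c x) + (\<Sum>i\<in>UNIV. hp i x * fp i x + hm i x * fm i x)) x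
        + ?E (\<lambda>x. ennreal (q x)) x
        = ?E (\<lambda>x. ennreal (c x) + (\<Sum>i\<in>UNIV. hp i x * fp i x + hm i x * fm i x) + ennreal (q x)) x"
      by (rule nn_cond_exp_sum; measurable)
    moreover have "AE x in M. ennreal (c x) = ?E (\<lambda>x. ennreal (c x)) x"
      by (rule nn_cond_exp_F_meas) measurable
    moreover have "AE x in M. ?E (\<lambda>x. \<Sum>i\<in>UNIV. hp i x * fp i x + hm i x * fm i x) x
        = (\<Sum>i\<in>UNIV. ?E (\<lambda>x. hp i x * fp i x + hm i x * fm i x) x)"
      by (rule nn_cond_exp_finite_sum) auto
    ultimately show ?thesis by eventually_elim simp
  qed
  have split': "AE x in M. ?E (\<lambda>x. X x + (\<Sum>i\<in>UNIV. hp i x * fm i x + hm i x * fp i x)) x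
      = ?E (\<lambda>x. ennreal (c x) + (\<Sum>i\<in>UNIV. hp i x * fp i x + hm i x * fm i x) + ennreal (q x)) x"
    by (rule nn_cond_exp_cong[OF split]) measurable
  have fin: "AE x in M. \<forall>i. ?E (fp i) x < \<infinity> \<and> ?E (fm i) x < \<infinity>"
  proof (intro AE_all_countable[THEN iffD2] allI)
    fix i
    have "AE x in M. ?E (fp i) x \<le> ?E (\<lambda>x. ennreal (norm (f x))) x"
      "AE x in M. ?E (fm i) x \<le> ?E (\<lambda>x. ennreal (norm (f x))) x"
      using component_le_norm_cart[of "f _" i]
      by (intro nn_cond_exp_mono AE_I2; auto simp: fp_def fm_def abs_le_iff intro!: ennreal_leI)+
    moreover have "AE x in M. ?E (\<lambda>x. ennreal (norm (f x))) x < \<infinity>"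
      using fg by (simp add: is_cond_exp_def)
    ultimately show "AE x in M. ?E (fp i) x < \<infinity> \<and> ?E (fm i) x < \<infinity>"
      by eventually_elim (auto intro: le_less_trans)
  qed
  have g: "AE x in M. \<forall>i. g x $ i = enn2real (?E (fp i) x) - enn2real (?E (fm i) x)"
  proof (intro AE_all_countable[THEN iffD2] allI)
    fix i
    have "AE x in M. real_cond_exp M F (\<lambda>x. f x $ i) x = g x $ i"
      using fg by (simp add: is_cond_exp_def)
    then show "AE x in M. g x $ i = enn2real (?E (fp i) x) - enn2real (?E (fm i) x)"
      by eventually_elim (simp add: real_cond_exp_def fp_def[abs_def] fm_def[abs_def])
  qed
  from c_nonneg q_finite split' lhs rhs prods fin g show ?thesis
  proof eventually_elim
    case (elim x)
    define u v where "u i = enn2real (?E (fp i) x)" and "v i = enn2real (?E (fm i) x)" for i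
    define e where "e = enn2real (?E (\<lambda>x. ennreal (q x)) x)"
    have uv: "?E (fp i) x = ennreal (u i)" "?E (fm i) x = ennreal (v i)" "u i \<ge> 0" "v i \<ge> 0" for i
      using elim(7) by (auto simp: u_def v_def)
    have e: "?E (\<lambda>x. ennreal (q x)) x = ennreal e" "e \<ge> 0"
      using elim(2) by (auto simp: e_def)
    let ?n = "\<lambda>i. max 0 (h x $ i) * v i + max 0 (- (h x $ i)) * u i"
    let ?p = "\<lambda>i. max 0 (h x $ i) * u i + max 0 (- (h x $ i)) * v i"
    have e0: "ennreal t = ennreal (max 0 t)" for t by (simp add: max_def ennreal_neg)
    have n: "hp i x * ennreal (v i) + hm i x * ennreal (u i) = ennreal (?n i)"
      and p: "hp i x * ennreal (u i) + hm i x * ennreal (v i) = ennreal (?p i)" for i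
      unfolding hp_def hm_def e0[of "h x $ i"] e0[of "- (h x $ i)"]
      using uv(3,4)[of i] by (simp_all add: ennreal_mult ennreal_plus)
    have np: "0 \<le> ?n i" "0 \<le> ?p i" for i using uv(3,4)[of i] by auto
    have "h x \<bullet> g x + (\<Sum>i\<in>UNIV. ?n i) = (\<Sum>i\<in>UNIV. ?p i)"
      unfolding inner_vec_def sum.distrib[symmetric]
    proof (intro sum.cong refl)
      fix i
      have gi: "g x $ i = u i - v i" using elim(8) by (simp add: u_def v_def)
      show "h x $ i \<bullet> g x $ i + ?n i = ?p i"
        by (simp add: gi max_def algebra_simps)
    qed
    then have eq: "c x + (\<Sum>i\<in>UNIV. ?p i) + e = c x + h x \<bullet> g x + e + (\<Sum>i\<in>UNIV. ?n i)" by simp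
    have "?E X x + ennreal (\<Sum>i\<in>UNIV. ?n i) = ennreal (c x) + ennreal (\<Sum>i\<in>UNIV. ?p i) + ennreal e"
      using elim(3-6) np by (simp add: uv(1,2) e(1) n p sum_ennreal)
    also have "\<dots> = ennreal (c x + (\<Sum>i\<in>UNIV. ?p i) + e)"
      using elim(1) e(2) np by (simp add: ennreal_plus sum_nonneg)
    finally have main: "?E X x + ennreal (\<Sum>i\<in>UNIV. ?n i) = ennreal (c x + (\<Sum>i\<in>UNIV. ?p i) + e)" .
    then have "?E X x \<le> ennreal (c x + (\<Sum>i\<in>UNIV. ?p i) + e)"
      by (metis le_iff_add)
    then have "?E X x < \<infinity>" by (simp add: le_less_trans)
    then obtain r where r: "?E X x = ennreal r" "r \<ge> 0" by (cases "?E X x") auto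
    have "r + (\<Sum>i\<in>UNIV. ?n i) = c x + (\<Sum>i\<in>UNIV. ?p i) + e"
      using main r(2) elim(1) e(2) np unfolding r(1)
      by (simp add: ennreal_plus[symmetric] sum_nonneg del: ennreal_plus)
    then have "r = c x + h x \<bullet> g x + e" using eq by simp
    then show ?case using r(1) unfolding X_def e_def by simp
  qed
qed

end

section \<open>The truncated procedure\<close>

text \<open>
  The deterministic core of the estimate, at one time and one \<open>\<omega>\<close>. \<open>L\<close> is the largest eigenvalue of
  \<open>C\<^sub>t\<close>, \<open>l\<close> the smallest one of \<open>C\<^sub>t\<^sub>-\<^sub>1\<close>, \<open>d = \<parallel>\<Delta>\<^sub>t\<^sub>-\<^sub>1\<parallel>\<^sup>2\<close>, and \<open>v\<close>, \<open>c\<close> are the forms of \<open>C\<^sub>t\<^sub>-\<^sub>1\<close> and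
  \<open>C\<^sub>t\<close> at \<open>\<Delta>\<^sub>t\<^sub>-\<^sub>1\<close>; \<open>k\<close> is the cross term and \<open>e\<close> the conditional second moment of the step. The two
  positive parts on the right are the summands of the series in (R1) and (R2).
\<close>

lemma lyapunov_drift_bound:
  fixes L l d v c k P \<rho> e :: real
  assumes "0 < L" "0 < l" "0 \<le> d" "c \<le> L * d" "l * d \<le> v"
    and drift: "k / L + P \<le> - \<rho> * d"
  shows "c + k + L * e
    \<le> v + (max ((L - l) / l - L / l * \<rho>) 0 + L * max (e - P) 0 / (1 + l * d)) * (1 + v)"
proof -
  define r where "r = max ((L - l) / l - L / l * \<rho>) 0"
  define B where "B = L * max (e - P) 0 / (1 + l * d)"
  have ld: "0 \<le> l * d" using assms by simp
  have "0 \<le> v" using ld assms(5) by simp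
  have "L - l - L * \<rho> = l * ((L - l) / l - L / l * \<rho>)"
    using assms(2) by (simp add: field_simps)
  also have "\<dots> \<le> l * r"
    using assms(2) by (intro mult_left_mono) (auto simp: r_def)
  finally have "(L - l - L * \<rho>) * d \<le> l * r * d"
    using assms(3) by (rule mult_right_mono)
  moreover have "r * (l * d) \<le> r * v"
    using assms(5) by (intro mult_left_mono) (auto simp: r_def)
  moreover have "r * v \<le> r * (1 + v)"
    by (intro mult_left_mono) (auto simp: r_def)
  ultimately have 1: "(L - L * \<rho>) * d \<le> v + r * (1 + v)"
    using assms(5) by (simp add: algebra_simps)
  have "L * (k / L + P) \<le> L * (- \<rho> * d)"
    using assms(1) drift by (intro mult_left_mono) auto
  then have 2: "k \<le> - L * \<rho> * d - L * P"
    using assms(1) by (simp add: algebra_simps)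
  have "L * (e - P) \<le> L * max (e - P) 0"
    using assms(1) by (intro mult_left_mono) auto
  also have "\<dots> = B * (1 + l * d)"
    using ld by (simp add: B_def)
  also have "\<dots> \<le> B * (1 + v)"
    using assms(1,5) ld by (intro mult_left_mono) (auto simp: B_def)
  finally have 3: "L * e \<le> L * P + B * (1 + v)"
    by (simp add: algebra_simps)
  have "c + k + L * e \<le> (L - L * \<rho>) * d + B * (1 + v)"
    using 2 3 assms(4) by (simp add: algebra_simps)
  also have "\<dots> \<le> v + (r + B) * (1 + v)"
    using 1 by (simp add: algebra_simps)
  finally show ?thesis by (simp add: r_def B_def)
qed

context truncated_SA
begin

lemma discrete_filtration_F: "discrete_filtration M F"
  by unfold_locales (use subalg sets_F_mono in auto)

text \<open>
  The truncation sets are random, so that measurability of the projected point is not immediate;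
  it follows since projections onto closed convex sets are continuous.
\<close>

lemma Z_adapted: "Z n \<in> borel_measurable (F n)"
proof (induction n)
  case 0
  show ?case by (rule Z_start)
next
  case (Suc n)
  interpret D: discrete_filtration M F by (rule discrete_filtration_F)
  have [measurable]: "Z n \<in> borel_measurable (F (Suc n))"
    using Suc by (rule D.measurable_F_Suc)
  have "(\<lambda>\<omega>. \<gamma> (Suc n) (Z n \<omega>) \<omega>) \<in> borel_measurable (F (Suc n))"
    using gamma_frozen[of "Suc n"] by (intro D.measurable_F_Suc) simp
  moreover have [measurable]: "(\<lambda>\<omega>. R (Suc n) (Z n \<omega>) \<omega>) \<in> borel_measurable (F (Suc n))"
    using Psi_frozen[of "Suc n"] by (intro D.measurable_F_Suc) (simp add: is_cond_exp_def)
  moreover have [measurable]: "(\<lambda>\<omega>. \<epsilon> (Suc n) (Z n \<omega>) \<omega>) \<in> borel_measurable (F (Suc n))"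
    using eps_frozen[of "Suc n"] by simp
  ultimately have [measurable]: "(\<lambda>\<omega>. \<gamma> (Suc n) (Z n \<omega>) \<omega> *v (R (Suc n) (Z n \<omega>) \<omega> + \<epsilon> (Suc n) (Z n \<omega>) \<omega>))
      \<in> borel_measurable (F (Suc n))"
    by (intro borel_measurable_matrix_vector_mult) auto
  have "(\<lambda>\<omega>. closest_point (U (Suc n) \<omega>)
      (Z n \<omega> + \<gamma> (Suc n) (Z n \<omega>) \<omega> *v (R (Suc n) (Z n \<omega>) \<omega> + \<epsilon> (Suc n) (Z n \<omega>) \<omega>)))
      \<in> borel_measurable (F (Suc n))"
  proof (rule borel_measurable_caratheodory[where f = "\<lambda>\<omega>. closest_point (U (Suc n) \<omega>)"])
    show "(\<lambda>\<omega>. closest_point (U (Suc n) \<omega>) z) \<in> borel_measurable (F (Suc n))" for z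
      using U_admissible by (simp add: admissible_def)
    show "continuous_on UNIV (closest_point (U (Suc n) \<omega>))" if "\<omega> \<in> space (F (Suc n))" for \<omega>
      using U_admissible that
      by (intro continuous_on_closest_point) (auto simp: admissible_def space_F)
  qed measurable
  then show ?case
    by (rule measurable_cong[THEN iffD1, rotated]) (use Z_step[of "Suc n"] in \<open>auto simp: space_F\<close>)
qed

end

text \<open>
  In the proof, \<open>v n\<close> is the form of \<open>C\<^sub>n\<close> at \<open>\<Delta>\<^sub>n\<close> and \<open>x n\<close> the form of \<open>C\<^sub>n\<^sub>+\<^sub>1\<close> at the untruncated point
  reached from \<open>\<Delta>\<^sub>n\<close> by the step \<open>w n\<close>.
\<close>

(* The series run over t >= 1 with t = Suc n. In R2 subtraction on ennreal truncates at 0, so that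
   E - P is the positive part [E - P]^+, and an infinite conditional expectation makes the sum
   infinite. *)
theorem lemma3p9:
  fixes M :: "'a measure" and F :: "nat \<Rightarrow> 'a measure"
    and R \<epsilon> :: "nat \<Rightarrow> real^'m \<Rightarrow> 'a \<Rightarrow> real^'m"
    and \<gamma> :: "nat \<Rightarrow> real^'m \<Rightarrow> 'a \<Rightarrow> real^'m^'m"
    and z0 :: "real^'m"
    and U :: "nat \<Rightarrow> 'a \<Rightarrow> (real^'m) set"
    and Z \<Delta> :: "nat \<Rightarrow> 'a \<Rightarrow> real^'m"
    and C :: "nat \<Rightarrow> 'a \<Rightarrow> real^'m^'m"
    and V :: "nat \<Rightarrow> 'a \<Rightarrow> real^'m \<Rightarrow> real"
    and P \<rho> :: "nat \<Rightarrow> 'a \<Rightarrow> real"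
  assumes SA: "truncated_SA M F R \<epsilon> \<gamma> z0 U Z"
    and C_pred: "predictable F C"
    and C_0: "C 0 \<in> borel_measurable (F 0)"
    and C_pos: "\<And>t. AE \<omega> in M. sym_pos_def (C t \<omega>)"
    and Delta: "\<And>t \<omega>. \<Delta> t \<omega> = Z t \<omega> - z0"
    and V: "\<And>t \<omega> u. V t \<omega> u = u \<bullet> (C t \<omega> *v u)"
    and V1: "AE \<omega> in M. \<forall>\<^sub>F t in sequentially.
      V t \<omega> (\<Delta> t \<omega>) \<le> V t \<omega> (\<Delta> (t - 1) \<omega>
        + \<gamma> t (Z (t - 1) \<omega>) \<omega> *v (R t (Z (t - 1) \<omega>) \<omega> + \<epsilon> t (Z (t - 1) \<omega>) \<omega>))"
    and P_pred: "predictable F P"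
    and P_nonneg: "\<And>t. t \<ge> 1 \<Longrightarrow> AE \<omega> in M. 0 \<le> P t \<omega>"
    and rho_pred: "predictable F \<rho>"
    and rho_nonneg: "\<And>t. t \<ge> 1 \<Longrightarrow> AE \<omega> in M. 0 \<le> \<rho> t \<omega>"
    and R1: "AE \<omega> in M. \<forall>\<^sub>F t in sequentially.
      2 * (\<Delta> (t - 1) \<omega> \<bullet>
            (C t \<omega> *v (\<gamma> t (z0 + \<Delta> (t - 1) \<omega>) \<omega> *v R t (z0 + \<Delta> (t - 1) \<omega>) \<omega>)))
          / lambda_max (C t \<omega>) + P t \<omega>
        \<le> - \<rho> t \<omega> * (norm (\<Delta> (t - 1) \<omega>))\<^sup>2"
    and R1_sum: "AE \<omega> in M. summable (\<lambda>n.
      max ((lambda_max (C (Suc n) \<omega>) - lambda_min (C n \<omega>)) / lambda_min (C n \<omega>)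
           - lambda_max (C (Suc n) \<omega>) / lambda_min (C n \<omega>) * \<rho> (Suc n) \<omega>) 0)"
    and R2: "AE \<omega> in M. (\<Sum>n.
      ennreal (lambda_max (C (Suc n) \<omega>)) *
        (nn_cond_exp M (F n)
           (\<lambda>\<omega>. ennreal ((norm (\<gamma> (Suc n) (z0 + \<Delta> n \<omega>) \<omega> *v
              (R (Suc n) (z0 + \<Delta> n \<omega>) \<omega> + \<epsilon> (Suc n) (z0 + \<Delta> n \<omega>) \<omega>)))\<^sup>2)) \<omega>
         - ennreal (P (Suc n) \<omega>))
      / ennreal (1 + lambda_min (C n \<omega>) * (norm (\<Delta> n \<omega>))\<^sup>2)) < \<infinity>"
  shows "AE \<omega> in M. convergent (\<lambda>t. (Z t \<omega> - z0) \<bullet> (C t \<omega> *v (Z t \<omega> - z0)))"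
proof -
  interpret truncated_SA M F R \<epsilon> \<gamma> z0 U Z by (rule SA)
  interpret D: discrete_filtration M F by (rule discrete_filtration_F)
  define G where "G n \<omega> = \<gamma> (Suc n) (Z n \<omega>) \<omega>" for n \<omega>
  define r where "r n \<omega> = R (Suc n) (Z n \<omega>) \<omega>" for n \<omega>
  define \<Psi> where "\<Psi> n \<omega> = r n \<omega> + \<epsilon> (Suc n) (Z n \<omega>) \<omega>" for n \<omega>
  define w where "w n \<omega> = G n \<omega> *v \<Psi> n \<omega>" for n \<omega>
  define v where "v n \<omega> = \<Delta> n \<omega> \<bullet> (C n \<omega> *v \<Delta> n \<omega>)" for n \<omega>
  define x where "x n \<omega> = (\<Delta> n \<omega> + w n \<omega>) \<bullet> (C (Suc n) \<omega> *v (\<Delta> n \<omega> + w n \<omega>))" for n \<omega>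
  define E2 where "E2 n = nn_cond_exp M (F n) (\<lambda>\<omega>. ennreal ((norm (w n \<omega>))\<^sup>2))" for n
  define a where "a n \<omega> = max ((lambda_max (C (Suc n) \<omega>) - lambda_min (C n \<omega>)) / lambda_min (C n \<omega>)
           - lambda_max (C (Suc n) \<omega>) / lambda_min (C n \<omega>) * \<rho> (Suc n) \<omega>) 0" for n \<omega>
  define b where "b n \<omega> = ennreal (lambda_max (C (Suc n) \<omega>)) * (E2 n \<omega> - ennreal (P (Suc n) \<omega>))
      / ennreal (1 + lambda_min (C n \<omega>) * (norm (\<Delta> n \<omega>))\<^sup>2)" for n \<omega>
  have frozen: "z0 + \<Delta> n \<omega> = Z n \<omega>" for n \<omega>
    by (simp add: Delta)

  have Delta_meas: "\<Delta> n \<in> borel_measurable (F n)" for n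
    unfolding Delta[abs_def] by (intro borel_measurable_diff Z_adapted) simp
  have C_meas: "C n \<in> borel_measurable (F n)" and C_Suc_meas: "C (Suc n) \<in> borel_measurable (F n)" for n
  proof -
    show C_Suc: "C (Suc n) \<in> borel_measurable (F n)" for n
      using C_pred by (auto simp: predictable_def dest: spec[of _ "Suc n"])
    show "C n \<in> borel_measurable (F n)"
      using C_0 C_Suc D.measurable_F_Suc by (cases n) auto
  qed
  have G_meas: "G n \<in> borel_measurable (F n)" for n
    using gamma_frozen[of "Suc n"] by (simp add: G_def[abs_def])
  have \<Psi>_cond: "is_cond_exp M (F n) (\<Psi> n) (r n)" for n
    using Psi_frozen[of "Suc n"] by (simp add: \<Psi>_def[abs_def] r_def[abs_def])
  have r_meas: "r n \<in> borel_measurable (F n)" for n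
    using \<Psi>_cond by (simp add: is_cond_exp_def)
  have \<Psi>_meas: "\<Psi> n \<in> borel_measurable (F (Suc n))" for n
    unfolding \<Psi>_def[abs_def]
    by (intro borel_measurable_add D.measurable_F_Suc[OF r_meas]) (use eps_frozen[of "Suc n"] in simp)
  have w_meas: "w n \<in> borel_measurable (F (Suc n))" for n
    unfolding w_def[abs_def]
    by (intro borel_measurable_matrix_vector_mult D.measurable_F_Suc[OF G_meas] \<Psi>_meas)
  have v_meas: "v n \<in> borel_measurable (F n)" for n
    unfolding v_def[abs_def]
    by (intro borel_measurable_inner borel_measurable_matrix_vector_mult Delta_meas C_meas)
  have x_meas: "x n \<in> borel_measurable (F (Suc n))" for n
    unfolding x_def[abs_def]
    by (intro borel_measurable_inner borel_measurable_matrix_vector_mult borel_measurable_add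
        D.measurable_F_Suc[OF Delta_meas] w_meas C_meas)

  have pos: "AE \<omega> in M. \<forall>n. sym_pos_def (C n \<omega>)"
    using C_pos by (simp add: AE_all_countable)
  have P_nonneg': "AE \<omega> in M. \<forall>n. 0 \<le> P (Suc n) \<omega>"
    using P_nonneg by (simp add: AE_all_countable)
  have b_sum: "AE \<omega> in M. (\<Sum>n. b n \<omega>) < \<infinity>"
    using R2 unfolding frozen b_def E2_def w_def \<Psi>_def r_def G_def .
  have b_finite: "AE \<omega> in M. \<forall>n. b n \<omega> < \<infinity>"
    using b_sum by eventually_elim (rule ennreal_suminf_finite_imp_terms_finite)
  \<comment> \<open>An infinite conditional second moment would make a term of the series in (R2) infinite, since
    its factor, the largest eigenvalue, is positive.\<close>
  have E2_finite: "AE \<omega> in M. \<forall>n. E2 n \<omega> < \<infinity>"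
    using b_finite pos
  proof eventually_elim
    case (elim \<omega>)
    show ?case
    proof
      fix n
      have L: "lambda_max (C (Suc n) \<omega>) > 0" using elim(2) lambda_pos by blast
      show "E2 n \<omega> < \<infinity>"
      proof (rule ccontr)
        assume "\<not> ?thesis"
        then have "E2 n \<omega> = \<top>" by (simp add: less_top[symmetric])
        then have "b n \<omega> = \<top>"
          using L by (simp add: b_def ennreal_mult_top ennreal_top_divide)
        with elim(1) show False by (metis infinity_ennreal_def less_irrefl)
      qed
    qed
  qed

  have cond: "AE \<omega> in M. nn_cond_exp M (F n) (\<lambda>\<omega>. ennreal (x n \<omega>)) \<omega>
      \<le> ennreal (\<Delta> n \<omega> \<bullet> (C (Suc n) \<omega> *v \<Delta> n \<omega>)
          + 2 * (\<Delta> n \<omega> \<bullet> (C (Suc n) \<omega> *v (G n \<omega> *v r n \<omega>)))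
          + lambda_max (C (Suc n) \<omega>) * enn2real (E2 n \<omega>))" for n
  proof -
    interpret S: sigma_finite_subalgebra M "F n" by (rule D.sigma_finite_subalgebra_F)
    \<comment> \<open>Expansion \<open>x n = c + h\<^sup>T \<Psi> n + q\<close>. The vector \<open>h\<close> is written without using symmetry of
      \<open>C (Suc n)\<close>, which holds only almost surely, so that the identity holds everywhere.\<close>
    define c where "c \<omega> = \<Delta> n \<omega> \<bullet> (C (Suc n) \<omega> *v \<Delta> n \<omega>)" for \<omega>
    define h where "h \<omega> = transpose (G n \<omega>) *v
        (C (Suc n) \<omega> *v \<Delta> n \<omega> + transpose (C (Suc n) \<omega>) *v \<Delta> n \<omega>)" for \<omega>
    define q where "q \<omega> = w n \<omega> \<bullet> (C (Suc n) \<omega> *v w n \<omega>)" for \<omega>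
    define L where "L \<omega> = ennreal (rayleigh_sup (C (Suc n) \<omega>))" for \<omega>
    have wM: "w n \<in> borel_measurable M" by (rule D.measurable_F_M[OF w_meas])
    have c_meas: "c \<in> borel_measurable (F n)"
      unfolding c_def[abs_def]
      by (intro borel_measurable_inner borel_measurable_matrix_vector_mult Delta_meas C_Suc_meas)
    have h_meas: "h \<in> borel_measurable (F n)"
      unfolding h_def[abs_def]
      by (intro borel_measurable_matrix_vector_mult borel_measurable_transpose borel_measurable_add
          Delta_meas C_Suc_meas G_meas)
    have q_meas: "q \<in> borel_measurable M"
      unfolding q_def[abs_def]
      by (intro borel_measurable_inner borel_measurable_matrix_vector_mult wM D.measurable_F_M[OF C_Suc_meas])
    have L_meas: "L \<in> borel_measurable (F n)"
      unfolding L_def[abs_def]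
      using measurable_compose[OF C_Suc_meas borel_measurable_rayleigh_sup] by simp
    have w2_meas: "(\<lambda>\<omega>. ennreal ((norm (w n \<omega>))\<^sup>2)) \<in> borel_measurable M"
      using wM by simp
    have h_inner: "h \<omega> \<bullet> y = \<Delta> n \<omega> \<bullet> (C (Suc n) \<omega> *v (G n \<omega> *v y)) + (G n \<omega> *v y) \<bullet> (C (Suc n) \<omega> *v \<Delta> n \<omega>)"
      for \<omega> y
    proof -
      have adj: "(transpose A *v s) \<bullet> t = s \<bullet> (A *v t)" for A :: "real^'m^'m" and s t
        using dot_lmul_matrix[of s A t] by (simp add: transpose_matrix_vector)
      show ?thesis
        unfolding h_def adj inner_add_left by (simp add: adj inner_commute)
    qed
    have x_eq: "x n \<omega> = c \<omega> + h \<omega> \<bullet> \<Psi> n \<omega> + q \<omega>" for \<omega>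
      unfolding h_inner w_def[symmetric]
      by (simp add: x_def c_def q_def matrix_vector_right_distrib inner_add_left inner_add_right)
    \<comment> \<open>The measurable \<open>rayleigh_sup\<close> stands in for \<open>lambda_max\<close> until the factor has been taken out of
      the conditional expectation.\<close>
    have q_le: "AE \<omega> in M. ennreal (q \<omega>) \<le> L \<omega> * ennreal ((norm (w n \<omega>))\<^sup>2)"
      using pos
    proof eventually_elim
      case (elim \<omega>)
      have "q \<omega> \<le> rayleigh_sup (C (Suc n) \<omega>) * (norm (w n \<omega>))\<^sup>2"
        unfolding q_def by (rule rayleigh_sup_attained)
      then show ?case
        unfolding L_def by (subst ennreal_mult''[symmetric]) (auto intro!: ennreal_leI)
    qed
    have "AE \<omega> in M. nn_cond_exp M (F n) (\<lambda>\<omega>. ennreal (q \<omega>)) \<omega>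
        \<le> nn_cond_exp M (F n) (\<lambda>\<omega>. L \<omega> * ennreal ((norm (w n \<omega>))\<^sup>2)) \<omega>"
      by (rule S.nn_cond_exp_mono[OF q_le])
        (use q_meas w2_meas D.measurable_F_M[OF L_meas] in auto)
    moreover have "AE \<omega> in M. L \<omega> * E2 n \<omega> = nn_cond_exp M (F n) (\<lambda>\<omega>. L \<omega> * ennreal ((norm (w n \<omega>))\<^sup>2)) \<omega>"
      unfolding E2_def by (rule S.nn_cond_exp_prod[OF L_meas w2_meas])
    ultimately have Eq: "AE \<omega> in M. nn_cond_exp M (F n) (\<lambda>\<omega>. ennreal (q \<omega>)) \<omega> \<le> L \<omega> * E2 n \<omega>"
      by eventually_elim simp
    have "AE \<omega> in M. nn_cond_exp M (F n) (\<lambda>\<omega>. ennreal (c \<omega> + h \<omega> \<bullet> \<Psi> n \<omega> + q \<omega>)) \<omega>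
        = ennreal (c \<omega> + h \<omega> \<bullet> r n \<omega> + enn2real (nn_cond_exp M (F n) (\<lambda>\<omega>. ennreal (q \<omega>)) \<omega>))"
    proof (rule S.nn_cond_exp_affine[OF \<Psi>_cond c_meas h_meas q_meas])
      show "AE \<omega> in M. 0 \<le> c \<omega>" "AE \<omega> in M. 0 \<le> q \<omega>" "AE \<omega> in M. 0 \<le> c \<omega> + h \<omega> \<bullet> \<Psi> n \<omega> + q \<omega>"
        unfolding x_eq[symmetric] unfolding x_def c_def q_def
        using pos by (eventually_elim, simp add: sym_pos_def_nonneg)+
      show "AE \<omega> in M. nn_cond_exp M (F n) (\<lambda>\<omega>. ennreal (q \<omega>)) \<omega> < \<infinity>"
        using Eq E2_finite
      proof eventually_elim
        case (elim \<omega>)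
        have "L \<omega> * E2 n \<omega> < \<infinity>" using elim(2) by (auto simp: L_def ennreal_mult_less_top)
        with elim(1) show ?case by (rule le_less_trans)
      qed
    qed
    then show ?thesis
      using Eq E2_finite pos
    proof eventually_elim
      case (elim \<omega>)
      have sym: "transpose (C (Suc n) \<omega>) = C (Suc n) \<omega>" using elim(4) by (simp add: sym_pos_def_def)
      have "h \<omega> \<bullet> r n \<omega> = 2 * (\<Delta> n \<omega> \<bullet> (C (Suc n) \<omega> *v (G n \<omega> *v r n \<omega>)))"
        unfolding h_inner using inner_matrix_symmetric[OF sym, of "\<Delta> n \<omega>"] by simp
      moreover have "enn2real (nn_cond_exp M (F n) (\<lambda>\<omega>. ennreal (q \<omega>)) \<omega>)
          \<le> lambda_max (C (Suc n) \<omega>) * enn2real (E2 n \<omega>)"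
      proof -
        have "lambda_max (C (Suc n) \<omega>) > 0" using elim(4) lambda_pos by blast
        moreover have "L \<omega> * E2 n \<omega> < \<infinity>" using elim(3) by (auto simp: L_def ennreal_mult_less_top)
        ultimately show ?thesis
          using enn2real_mono[OF elim(2)] by (simp add: L_def lambda_max_eq_rayleigh_sup[OF sym] enn2real_mult)
      qed
      ultimately show ?case
        using elim(1) unfolding x_eq by (auto simp: c_def intro!: ennreal_leI)
    qed
  qed

  have "AE \<omega> in M. \<exists>l<\<infinity>. (\<lambda>n. ennreal (v n \<omega>)) \<longlonglongrightarrow> l"
  proof (rule D.robbins_siegmund[where X = "\<lambda>n \<omega>. ennreal (x n \<omega>)"
        and b = "\<lambda>n \<omega>. ennreal (a n \<omega>) + b n \<omega>"])
    show "(\<lambda>\<omega>. ennreal (v n \<omega>)) \<in> borel_measurable (F n)" for n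
      using v_meas by simp
    show "(\<lambda>\<omega>. ennreal (x n \<omega>)) \<in> borel_measurable (F (Suc n))" for n
      using x_meas by simp
    show "AE \<omega> in M. \<forall>\<^sub>F n in sequentially. ennreal (v (Suc n) \<omega>) \<le> ennreal (x n \<omega>)"
      using V1
    proof eventually_elim
      case (elim \<omega>)
      then have "\<forall>\<^sub>F n in sequentially. v (Suc n) \<omega> \<le> x n \<omega>"
        unfolding eventually_sequentially_Suc[of "\<lambda>t. V t \<omega> (\<Delta> t \<omega>) \<le> _ t", symmetric]
        by (simp add: V v_def x_def w_def \<Psi>_def r_def G_def)
      then show ?case by eventually_elim (auto intro: ennreal_leI)
    qed
    show "AE \<omega> in M. (\<Sum>n. ennreal (a n \<omega>) + b n \<omega>) < \<infinity>"
      using b_sum R1_sum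
    proof eventually_elim
      case (elim \<omega>)
      have "(\<Sum>n. ennreal (a n \<omega>)) < \<infinity>"
        using elim(2) by (subst suminf_ennreal2) (auto simp: a_def)
      moreover have "(\<Sum>n. ennreal (a n \<omega>) + b n \<omega>) = (\<Sum>n. ennreal (a n \<omega>)) + (\<Sum>n. b n \<omega>)"
        by (intro suminf_add[symmetric]) auto
      ultimately show ?case using elim(1) by simp
    qed
    show "AE \<omega> in M. \<forall>n. ennreal (v n \<omega>) < \<infinity>"
      by simp
    have "AE \<omega> in M. \<forall>n. nn_cond_exp M (F n) (\<lambda>\<omega>. ennreal (x n \<omega>)) \<omega>
      \<le> ennreal (\<Delta> n \<omega> \<bullet> (C (Suc n) \<omega> *v \<Delta> n \<omega>)
          + 2 * (\<Delta> n \<omega> \<bullet> (C (Suc n) \<omega> *v (G n \<omega> *v r n \<omega>)))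
          + lambda_max (C (Suc n) \<omega>) * enn2real (E2 n \<omega>))"
      using cond by (simp add: AE_all_countable)
    then show "AE \<omega> in M. \<forall>\<^sub>F n in sequentially.
        nn_cond_exp M (F n) (\<lambda>\<omega>. ennreal (x n \<omega>)) \<omega>
        \<le> ennreal (v n \<omega>) + (ennreal (a n \<omega>) + b n \<omega>) * (1 + ennreal (v n \<omega>))"
      using R1 pos E2_finite P_nonneg'
    proof eventually_elim
      case (elim \<omega>)
      note cond = elim(1) and pos = elim(3) and fin = elim(4) and P_nonneg = elim(5)
      have "\<forall>\<^sub>F n in sequentially. 2 * (\<Delta> n \<omega> \<bullet> (C (Suc n) \<omega> *v (G n \<omega> *v r n \<omega>)))
          / lambda_max (C (Suc n) \<omega>) + P (Suc n) \<omega> \<le> - \<rho> (Suc n) \<omega> * (norm (\<Delta> n \<omega>))\<^sup>2"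
        using elim(2) unfolding frozen G_def r_def
        by (subst (asm) eventually_sequentially_Suc[symmetric]) simp
      then show ?case
      proof eventually_elim
        case (elim n)
        define L l d e B where "L = lambda_max (C (Suc n) \<omega>)" and "l = lambda_min (C n \<omega>)"
          and "d = (norm (\<Delta> n \<omega>))\<^sup>2" and "e = enn2real (E2 n \<omega>)"
          and "B = L * max (e - P (Suc n) \<omega>) 0 / (1 + l * d)"
        have sym: "transpose (C k \<omega>) = C k \<omega>" for k using pos by (simp add: sym_pos_def_def)
        have lL: "0 < L" "0 < l" using pos lambda_pos by (auto simp: L_def l_def)
        have d: "0 \<le> d" by (simp add: d_def)
        have v0: "0 \<le> v n \<omega>" unfolding v_def using pos by (intro sym_pos_def_nonneg) simp
        have B0: "0 \<le> B" using lL d by (auto simp: B_def)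
        have ld: "0 < 1 + l * d" using lL d by (intro add_pos_nonneg mult_nonneg_nonneg) auto
        have "E2 n \<omega> = ennreal e" using fin by (simp add: e_def)
        then have "E2 n \<omega> - ennreal (P (Suc n) \<omega>) = ennreal (e - P (Suc n) \<omega>)"
          using P_nonneg by (simp add: ennreal_minus)
        also have "\<dots> = ennreal (max (e - P (Suc n) \<omega>) 0)"
          by (simp add: max_def ennreal_neg)
        finally have "b n \<omega> = ennreal L * ennreal (max (e - P (Suc n) \<omega>) 0) / ennreal (1 + l * d)"
          by (simp only: b_def L_def l_def d_def)
        also have "\<dots> = ennreal B"
          unfolding B_def using lL ld by (subst ennreal_mult[symmetric]) (auto simp: divide_ennreal)
        finally have bB: "b n \<omega> = ennreal B" .
        have "\<Delta> n \<omega> \<bullet> (C (Suc n) \<omega> *v \<Delta> n \<omega>) + 2 * (\<Delta> n \<omega> \<bullet> (C (Suc n) \<omega> *v (G n \<omega> *v r n \<omega>))) + L * e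
            \<le> v n \<omega> + (a n \<omega> + B) * (1 + v n \<omega>)"
          unfolding a_def B_def L_def[symmetric] l_def[symmetric]
        proof (rule lyapunov_drift_bound[OF lL d])
          show "\<Delta> n \<omega> \<bullet> (C (Suc n) \<omega> *v \<Delta> n \<omega>) \<le> L * d"
            unfolding L_def d_def by (rule quadratic_form_le_lambda_max[OF sym])
          show "l * d \<le> v n \<omega>"
            unfolding l_def d_def v_def by (rule lambda_min_le_quadratic_form[OF sym])
        qed (use elim in \<open>simp add: L_def d_def\<close>)
        then have "nn_cond_exp M (F n) (\<lambda>\<omega>. ennreal (x n \<omega>)) \<omega> \<le> ennreal (v n \<omega> + (a n \<omega> + B) * (1 + v n \<omega>))"
          using cond by (auto simp: L_def e_def intro: order_trans ennreal_leI)
        also have "\<dots> = ennreal (v n \<omega>) + (ennreal (a n \<omega>) + b n \<omega>) * (1 + ennreal (v n \<omega>))"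
          unfolding bB using v0 B0 by (simp add: ennreal_plus ennreal_mult a_def)
        finally show ?case by simp
      qed
    qed
  qed
  with pos show ?thesis
  proof eventually_elim
    case (elim \<omega>)
    then obtain l where l: "l < \<infinity>" "(\<lambda>n. ennreal (v n \<omega>)) \<longlonglongrightarrow> l" by blast
    have "v n \<omega> \<ge> 0" for n unfolding v_def using elim(1) by (intro sym_pos_def_nonneg) simp
    with l have "(\<lambda>n. v n \<omega>) \<longlonglongrightarrow> enn2real l"
      using tendsto_enn2real[of "\<lambda>n. ennreal (v n \<omega>)" "enn2real l" sequentially] by simp
    then show ?case
      unfolding convergent_def v_def Delta by blast
  qed
qed

end
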